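(* Let $n\geq 7$. Suppose $G_0\in\mathfrak{C}_{n,1}$ and $v_0\in V(G_0)$ satisfy $f_{G_0}(v_0)=\min\{f_G(v): G\in\mathfrak{C}_{n,1},\ v\in V(G)\}$. Then $G_0\cong L_{n,n-1}$ and $v_0$ is the pendant vertex of $L_{n,n-1}$.
   Context: All graphs are simple, finite, undirected and connected. A connected subgraph of $G$ is a connected subgraph in the usual sense (nonempty vertex subset with a subset of edges among them); distinct subgraphs are counted separately. $f_G(v)$ is the number of connected subgraphs of $G$ containing $v$. $\mathfrak{C}_{n,k}$ is the family of connected graphs on $n$ vertices with exactly $k$ cut vertices. $L_{n,n-1}$ is the graph obtained from the cycle $C_{n-1}$ by attaching one new pendant vertex adjacent to a vertex of the cycle. *)

theory Defs
  imports "Graph_Theory.Graph_Theory"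
begin

text \<open>
  A finite simple undirected graph is a \<^locale>\<open>pair_graph\<close>: an edge is represented by its two
  opposite arcs. A subgraph in the undirected sense is a \<^const>\<open>subgraph\<close> that is itself a
  \<^locale>\<open>pair_graph\<close>, i.e. whose arc set is again symmetric. The predicate \<^const>\<open>connected\<close>
  includes nonemptiness of the vertex set.
\<close>

definition connected_subgraphs_at :: "'a pair_pre_digraph \<Rightarrow> 'a \<Rightarrow> 'a pair_pre_digraph set" where
  "connected_subgraphs_at G v =
     {H. pair_graph H \<and> subgraph (with_proj H) (with_proj G) \<and> connected (with_proj H)
         \<and> v \<in> pverts H}"

definition num_connected_subgraphs_at :: "'a pair_pre_digraph \<Rightarrow> 'a \<Rightarrow> nat" where
  "num_connected_subgraphs_at G v = card (connected_subgraphs_at G v)"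

text \<open>
  As arcs are symmetric, the strongly connected components are the components of the undirected
  graph.
\<close>

definition cut_vertex :: "'a pair_pre_digraph \<Rightarrow> 'a \<Rightarrow> bool" where
  "cut_vertex G v \<longleftrightarrow> v \<in> pverts G \<and>
     card (pre_digraph.sccs (with_proj G))
       < card (pre_digraph.sccs (pre_digraph.del_vert (with_proj G) v))"

definition connected_graphs_with_cut_vertices :: "nat \<Rightarrow> nat \<Rightarrow> 'a pair_pre_digraph set" where
  "connected_graphs_with_cut_vertices n k =
     {G. pair_graph G \<and> connected (with_proj G) \<and> card (pverts G) = n
         \<and> card {v. cut_vertex G v} = k}"

definition cycle_graph :: "nat \<Rightarrow> nat pair_pre_digraph" where
  "cycle_graph m =
     \<lparr> pverts = {..<m},
       parcs = {(i, j). i < m \<and> j < m \<and> (j = Suc i mod m \<or> i = Suc j mod m)} \<rparr>"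

definition attach_pendant :: "'a pair_pre_digraph \<Rightarrow> 'a \<Rightarrow> 'a \<Rightarrow> 'a pair_pre_digraph" where
  "attach_pendant G u w =
     \<lparr> pverts = insert w (pverts G), parcs = parcs G \<union> {(u, w), (w, u)} \<rparr>"

text \<open>The graph $L_{n,n-1}$; its pendant vertex is \<open>n - 1\<close>.\<close>

definition cycle_with_pendant :: "nat \<Rightarrow> nat pair_pre_digraph" where
  "cycle_with_pendant n = attach_pendant (cycle_graph (n - 1)) 0 (n - 1)"

text \<open>The minimum in question is taken over a finite set.\<close>

lemma num_connected_subgraphs_at_le:
  assumes "pair_graph G" "card (pverts G) = n"
  shows "num_connected_subgraphs_at G v \<le> 2 ^ n * 2 ^ (n * n)"
proof -
  interpret pair_graph G by fact
  let ?P = "Pow (pverts G) \<times> Pow (pverts G \<times> pverts G)"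
  let ?h = "\<lambda>H :: 'a pair_pre_digraph. (pverts H, parcs H)"
  have sub: "?h ` connected_subgraphs_at G v \<subseteq> ?P"
  proof (rule image_subsetI)
    fix H assume "H \<in> connected_subgraphs_at G v"
    then have "pverts H \<subseteq> pverts G" "parcs H \<subseteq> parcs G"
      by (simp_all add: connected_subgraphs_at_def subgraph_def)
    moreover have "parcs G \<subseteq> pverts G \<times> pverts G"
      by (auto dest: in_arcsD1 in_arcsD2)
    ultimately show "?h H \<in> ?P"
      by blast
  qed
  have inj: "inj_on ?h (connected_subgraphs_at G v)"
    by (rule inj_onI) simp
  have fin: "finite ?P"
    using pair_finite_verts by simp
  have "card (connected_subgraphs_at G v) \<le> card ?P"
    by (rule card_inj_on_le[OF inj sub fin])
  then show ?thesis
    using assms(2) pair_finite_verts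
    by (simp add: num_connected_subgraphs_at_def card_cartesian_product card_Pow)
qed

lemma finite_num_connected_subgraphs_at:
  "finite {num_connected_subgraphs_at G v | G v.
     G \<in> connected_graphs_with_cut_vertices n k \<and> v \<in> pverts G}"
  by (rule finite_subset[of _ "{..2 ^ n * 2 ^ (n * n)}"])
     (auto simp: connected_graphs_with_cut_vertices_def intro: num_connected_subgraphs_at_le)

end

theory Submission
  imports Defs
begin


text \<open>
  A connected subgraph containing \<open>v\<close> is the same as a symmetric edge set all of whose edges are reachable
  from \<open>v\<close>; allow a root set \<open>S\<close>, regarded as one contracted vertex, in place of \<open>v\<close>.
  Deleting or contracting an edge \<open>e = sw\<close> with \<open>s \<in> S\<close> gives
  \<open>f(E, S) \<ge> f(E, S \<union> {w}) + f(E - e, S)\<close>, and if \<open>k\<close> further vertices are reachable then the last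
  term is at least \<open>k + 1\<close>, even \<open>k + 2\<close> when there are more than \<open>k\<close> edges. Choosing \<open>w\<close> so that the
  block of the root stays a block, induction bounds \<open>f\<close> from below by its value for a cycle; equality
  leaves only as many edges as vertices, so the block is a cycle. If \<open>c\<close> is the cut vertex, then \<open>v = c\<close> is
  too expensive by multiplicativity of \<open>f\<close> at a cut vertex, and \<open>v \<noteq> c\<close> in a block
  with at least three vertices is too expensive because the choices beyond \<open>c\<close> are multiplied by at
  least three. So \<open>v\<close> is pendant at \<open>c\<close>, and what remains is a block with as few subgraphs as a cycle.
\<close>

section \<open>Edge sets rooted at a set of vertices\<close>

text \<open>The value to beat is n(n-1)/2 + 2, reached at the pendant vertex of
  \<open>cycle_with_pendant n\<close>: the pendant vertex alone, or the pendant edge together with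
  the whole cycle or with one of the n(n-1)/2 paths on the cycle through the attachment vertex. To
  avoid halves, bounds are stated for twice the count; hence the recurring
  \<open>card V * (card V - 1) + 4\<close>. A cycle on m vertices has m(m+1)/2 + 1, which appears as
  \<open>(card W + 1) * (card W + 2) + 2\<close> when \<open>W\<close> is the cycle without its
  root.

  The condition n \<ge> 7 is sharp: for n = 6 a leaf of the star K_{1,5} lies in 1 + 2^4 = 17
  connected subgraphs, exactly as many as the pendant vertex of L_{6,5}. It enters where the rest of
  the graph is split at the cut vertex: five vertices besides it are what makes the product of the
  two sides strictly larger than the cycle value.

  Contraction enlarges the root set instead of forming a quotient, so that parallel edges remain
  distinct arcs of one relation. An edge is a pair of opposite arcs, so \<open>card E\<close> is
  twice the number of edges.\<close>

definition reach :: "('a \<times> 'a) set \<Rightarrow> 'a set \<Rightarrow> 'a set" where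
  "reach E S = E\<^sup>* `` S"

definition avoiding :: "('a \<times> 'a) set \<Rightarrow> 'a \<Rightarrow> ('a \<times> 'a) set" where
  "avoiding E x = {(a, b) \<in> E. a \<noteq> x \<and> b \<noteq> x}"

text \<open>Arcs inside \<open>S \<times> S\<close> would be loops after contraction. Excluding them
  is what allows the arcs used between a contracted vertex and the root to be recovered from a
  union.\<close>

definition rooted_edge_sets :: "('a \<times> 'a) set \<Rightarrow> 'a set \<Rightarrow> ('a \<times> 'a) set set" where
  "rooted_edge_sets E S = {F. F \<subseteq> E \<and> sym F \<and> F \<inter> S \<times> S = {} \<and> Domain F \<subseteq> reach F S}"

section \<open>Elementary properties of reachability\<close>

lemma reach_refl: "S \<subseteq> reach E S"
  by (auto simp: reach_def)

lemma reach_root: "x \<in> S \<Longrightarrow> x \<in> reach E S"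
  using reach_refl by (rule subsetD)

lemma reach_step: "a \<in> reach E S \<Longrightarrow> (a, b) \<in> E \<Longrightarrow> b \<in> reach E S"
  by (auto simp: reach_def intro: rtrancl_into_rtrancl)

lemma reach_least:
  assumes "S \<subseteq> T" "\<And>a b. a \<in> T \<Longrightarrow> (a, b) \<in> E \<Longrightarrow> b \<in> T"
  shows "reach E S \<subseteq> T"
proof
  fix y assume "y \<in> reach E S"
  then obtain s where "s \<in> S" "(s, y) \<in> E\<^sup>*" by (auto simp: reach_def)
  from this(2) this(1) assms show "y \<in> T" by (induction rule: rtrancl_induct) auto
qed

lemma reach_mono: "E \<subseteq> E' \<Longrightarrow> S \<subseteq> S' \<Longrightarrow> reach E S \<subseteq> reach E' S'"
  by (rule reach_least) (use reach_refl[of S' E'] reach_step[of _ E' S'] in auto)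

lemma reach_exit:
  assumes "y \<in> reach E S" "S \<subseteq> T" "y \<notin> T"
  obtains a b where "a \<in> T" "b \<notin> T" "(a, b) \<in> E"
  using reach_least[of S T E] assms by blast

lemma reach_trans: "y \<in> reach E {x} \<Longrightarrow> x \<in> reach E S \<Longrightarrow> y \<in> reach E S"
  by (auto simp: reach_def intro: rtrancl_trans)

lemma reach_sym: "sym E \<Longrightarrow> y \<in> reach E {x} \<Longrightarrow> x \<in> reach E {y}"
  by (auto simp: reach_def dest: sym_rtrancl symD)

lemma sym_avoiding: "sym E \<Longrightarrow> sym (avoiding E x)"
  by (auto simp: avoiding_def sym_def)

lemma avoiding_subset: "avoiding E x \<subseteq> E"
  by (auto simp: avoiding_def)

lemma finite_rooted_edge_sets: "finite E \<Longrightarrow> finite (rooted_edge_sets E S)"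
  by (rule finite_subset[of _ "Pow E"]) (auto simp: rooted_edge_sets_def)

lemma empty_in_rooted_edge_sets: "{} \<in> rooted_edge_sets E S"
  by (auto simp: rooted_edge_sets_def sym_def)

lemma card_rooted_edge_sets_pos: "finite E \<Longrightarrow> card (rooted_edge_sets E S) \<ge> 1"
  using empty_in_rooted_edge_sets[of E S] finite_rooted_edge_sets[of E S]
  by (metis One_nat_def Suc_leI card_gt_0_iff empty_iff)

text \<open>Deletion and contraction of an edge from the root set to \<open>w\<close>; the sets in \<open>\<P>\<close> record
  which of the edges between \<open>w\<close> and the root set are used.\<close>

lemma card_rooted_edge_sets_contract_delete:
  assumes E: "finite E" "sym E" and s: "s \<in> S" "w \<notin> S"
    and P: "\<And>P. P \<in> \<P> \<Longrightarrow> P \<subseteq> E \<inter> (S \<times> {w} \<union> {w} \<times> S) \<and> sym P \<and> (s, w) \<in> P"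
  shows "card \<P> * card (rooted_edge_sets E (insert w S))
    + card (rooted_edge_sets (E - {(s, w), (w, s)}) S) \<le> card (rooted_edge_sets E S)"
proof -
  let ?A = "rooted_edge_sets E (insert w S)" and ?B = "rooted_edge_sets (E - {(s, w), (w, s)}) S"
  let ?X = "S \<times> {w} \<union> {w} \<times> S"
  let ?g = "\<lambda>(P, F). P \<union> F"
  \<comment> \<open>\<open>F\<close> has no arc inside \<open>insert w S\<close>, so intersecting
    with \<open>?X\<close> separates the two components; this gives injectivity of
    \<open>?g\<close>.\<close>
  have rec: "(P \<union> F) \<inter> ?X = P \<and> (P \<union> F) - ?X = F" if "P \<in> \<P>" "F \<in> ?A" for P F
  proof -
    have "P \<subseteq> ?X" using P[OF that(1)] by blast
    moreover have "F \<inter> ?X = {}" using that(2) s(1) by (auto simp: rooted_edge_sets_def)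
    ultimately show ?thesis by (intro conjI) auto
  qed
  have inj: "inj_on ?g (\<P> \<times> ?A)"
  proof (rule inj_onI, clarify)
    fix P F P' F' assume "P \<in> \<P>" "F \<in> ?A" "P' \<in> \<P>" "F' \<in> ?A" "P \<union> F = P' \<union> F'"
    then show "P = P' \<and> F = F'" using rec[of P F] rec[of P' F'] by metis
  qed
  have img: "?g ` (\<P> \<times> ?A) \<subseteq> {F \<in> rooted_edge_sets E S. (s, w) \<in> F}"
  proof (rule image_subsetI, clarify)
    fix P F assume PP: "P \<in> \<P>" and F: "F \<in> ?A"
    note p = P[OF PP]
    have sub: "P \<union> F \<subseteq> E" "sym (P \<union> F)"
      using p F by (auto simp: rooted_edge_sets_def sym_Un)
    have disj: "(P \<union> F) \<inter> S \<times> S = {}"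
      using p F s(2) by (auto simp: rooted_edge_sets_def)
    have w: "w \<in> reach (P \<union> F) S"
      using p s(1) reach_refl[of S "P \<union> F"] reach_step[of s "P \<union> F" S w] by auto
    have "reach F (insert w S) \<subseteq> reach (P \<union> F) S"
      by (rule reach_least) (use w reach_refl[of S "P \<union> F"] reach_step[of _ "P \<union> F" S] in auto)
    moreover have "Domain P \<subseteq> reach (P \<union> F) S"
      using p w reach_refl[of S "P \<union> F"] by auto
    ultimately have "Domain (P \<union> F) \<subseteq> reach (P \<union> F) S"
      using F by (auto simp: rooted_edge_sets_def)
    with sub disj p show "P \<union> F \<in> rooted_edge_sets E S \<and> (s, w) \<in> P \<union> F"
      by (auto simp: rooted_edge_sets_def)
  qed
  have B: "?B \<subseteq> {F \<in> rooted_edge_sets E S. (s, w) \<notin> F}"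
    by (auto simp: rooted_edge_sets_def)
  have fin: "finite (rooted_edge_sets E S)"
    by (rule finite_rooted_edge_sets[OF E(1)])
  have "card (\<P> \<times> ?A) \<le> card {F \<in> rooted_edge_sets E S. (s, w) \<in> F}"
    by (rule card_inj_on_le[OF inj img]) (use fin in auto)
  moreover have "card ?B \<le> card {F \<in> rooted_edge_sets E S. (s, w) \<notin> F}"
    by (rule card_mono[OF _ B]) (use fin in auto)
  moreover have "card (rooted_edge_sets E S) = card {F \<in> rooted_edge_sets E S. (s, w) \<in> F}
      + card {F \<in> rooted_edge_sets E S. (s, w) \<notin> F}"
    by (subst card_Un_disjoint[symmetric]) (use fin in \<open>auto intro: arg_cong[of _ _ card]\<close>)
  ultimately show ?thesis by (simp add: card_cartesian_product)
qed

corollary card_rooted_edge_sets_step: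
  assumes E: "finite E" "sym E" and s: "s \<in> S" "w \<notin> S" "(s, w) \<in> E"
  shows "card (rooted_edge_sets E (insert w S))
    + card (rooted_edge_sets (E - {(s, w), (w, s)}) S) \<le> card (rooted_edge_sets E S)"
  using card_rooted_edge_sets_contract_delete[OF E s(1,2), of "{{(s, w), (w, s)}}"] E(2) s
  by (auto simp: sym_def)

lemma reach_step_root:
  assumes "W \<noteq> {}" "W \<inter> S = {}" "W \<subseteq> reach E S" "E \<subseteq> (S \<union> W) \<times> (S \<union> W)"
  obtains s w where "s \<in> S" "w \<in> W" "(s, w) \<in> E"
proof -
  obtain y where y: "y \<in> W" "y \<in> reach E S" "y \<notin> S" using assms by blast
  from reach_exit[OF y(2) subset_refl y(3)] obtain a b where "a \<in> S" "b \<notin> S" "(a, b) \<in> E" .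
  then show thesis using that[of a b] assms(4) by auto
qed

text \<open>Contracting an edge that leaves \<open>S\<close> absorbs at most one vertex of
  \<open>W\<close>, and the empty set, which survives the deletion, pays for that vertex.\<close>

lemma card_rooted_edge_sets_ge_Suc:
  assumes "finite E" "sym E" "finite W" "W \<inter> S = {}" "W \<subseteq> reach E S"
  shows "Suc (card W) \<le> card (rooted_edge_sets E S)"
  using assms
proof (induction "card W" arbitrary: W S)
  case 0
  then show ?case using card_rooted_edge_sets_pos[of E S] by simp
next
  case (Suc k)
  then obtain y where y: "y \<in> W" by (metis card_eq_SucD insertI1)
  obtain s w where e: "s \<in> S" "w \<notin> S" "(s, w) \<in> E"
    using reach_exit[of y E S S] Suc.prems y by blast
  \<comment> \<open>The arcs may have ends outside \<open>S \<union> W\<close>, so \<open>w\<close>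
    need not lie in \<open>W\<close>; in that case an arbitrary vertex is dropped to keep the
    induction on \<open>card W\<close> going.\<close>
  obtain z where z: "z \<in> W" "w \<in> W \<longrightarrow> z = w" using y by blast
  have "Suc (card (W - {z})) \<le> card (rooted_edge_sets E (insert w S))"
  proof (rule Suc.hyps(1))
    show "k = card (W - {z})" using z Suc.hyps(2) Suc.prems(3) by simp
    show "(W - {z}) \<inter> insert w S = {}" using z Suc.prems(4) by blast
    show "W - {z} \<subseteq> reach E (insert w S)"
      using Suc.prems(5) reach_mono[of E E S "insert w S"] by blast
  qed (use Suc.prems in auto)
  moreover have "card (W - {z}) = k" using z Suc.hyps(2) Suc.prems(3) by simp
  moreover have "1 \<le> card (rooted_edge_sets (E - {(s, w), (w, s)}) S)"
    using Suc.prems(1) by (intro card_rooted_edge_sets_pos) auto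
  ultimately show ?case
    using card_rooted_edge_sets_step[OF Suc.prems(1,2) e] Suc.hyps(2) by simp
qed

text \<open>With more than \<open>card W\<close> edges there is a cycle after contraction of
  \<open>S\<close>. If \<open>w\<close> has a second edge to some \<open>t\<close> in
  \<open>S\<close>, deleting \<open>sw\<close> leaves two sets, the empty one and \<open>tw\<close>.
  Otherwise contraction uses up one edge together with one vertex, and the excess passes to the
  induction hypothesis.\<close>

lemma card_rooted_edge_sets_ge_Suc_Suc:
  assumes "finite E" "sym E" "finite W" "W \<inter> S = {}" "W \<subseteq> reach E S"
    and "E \<subseteq> (S \<union> W) \<times> (S \<union> W)" "irrefl E" "card (E - S \<times> S) > 2 * card W"
  shows "Suc (Suc (card W)) \<le> card (rooted_edge_sets E S)"
  using assms
proof (induction "card W" arbitrary: W S)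
  case 0
  then have "W = {}" by simp
  with 0 have "E - S \<times> S = {}" by blast
  with 0 show ?case by (metis card.empty not_less_zero)
next
  case (Suc k)
  then have "W \<noteq> {}" by auto
  obtain s w where e: "s \<in> S" "w \<in> W" "(s, w) \<in> E"
    using reach_step_root[OF \<open>W \<noteq> {}\<close> Suc.prems(4-6)] .
  then have w: "w \<notin> S" using Suc.prems(4) by blast
  let ?E = "E - {(s, w), (w, s)}"
  have k: "card (W - {w}) = k" using e Suc.hyps(2) Suc.prems(3) by simp
  have st: "card (rooted_edge_sets E (insert w S)) + card (rooted_edge_sets ?E S)
    \<le> card (rooted_edge_sets E S)"
    using card_rooted_edge_sets_step[OF Suc.prems(1,2) e(1) w e(3)] .
  have pre: "(W - {w}) \<inter> insert w S = {}" "W - {w} \<subseteq> reach E (insert w S)" "finite (W - {w})"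
    using Suc.prems(3,4,5) reach_mono[of E E S "insert w S"] by blast+
  show ?case
  proof (cases "\<exists>t \<in> S. t \<noteq> s \<and> (t, w) \<in> E")
    case True
    then obtain t where t: "t \<in> S" "t \<noteq> s" "(t, w) \<in> E" by blast
    then have t': "(w, t) \<in> E" using Suc.prems(2) by (auto dest: symD)
    have "{{}, {(t, w), (w, t)}} \<subseteq> rooted_edge_sets ?E S"
    proof -
      have "t \<in> reach {(t, w), (w, t)} S" using t reach_refl[of S] by blast
      moreover from this have "w \<in> reach {(t, w), (w, t)} S" by (rule reach_step) simp
      ultimately show ?thesis
        using t t' w e by (auto simp: rooted_edge_sets_def sym_def)
    qed
    from card_mono[OF finite_rooted_edge_sets this] Suc.prems(1)
    have "2 \<le> card (rooted_edge_sets ?E S)" by simp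
    moreover have "Suc k \<le> card (rooted_edge_sets E (insert w S))"
      using card_rooted_edge_sets_ge_Suc[OF Suc.prems(1,2) pre(3,1,2)] k by simp
    ultimately show ?thesis using st Suc.hyps(2) by simp
  next
    case False
    have "E - S \<times> S \<subseteq> (E - insert w S \<times> insert w S) \<union> {(s, w), (w, s)}"
      using False Suc.prems(2,7) by (auto simp: irrefl_def dest: symD)
    then have "card (E - S \<times> S) \<le> card ((E - insert w S \<times> insert w S) \<union> {(s, w), (w, s)})"
      using Suc.prems(1) by (intro card_mono) auto
    also have "\<dots> \<le> card (E - insert w S \<times> insert w S) + card {(s, w), (w, s)}"
      by (rule card_Un_le)
    also have "\<dots> \<le> card (E - insert w S \<times> insert w S) + 2"
      by (rule add_left_mono, rule order_trans[OF card_insert_le_m1[of 2]]) auto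
    finally have "2 * card (W - {w}) < card (E - insert w S \<times> insert w S)"
      using Suc.prems(8) k Suc.hyps(2) by simp
    moreover have "E \<subseteq> (insert w S \<union> (W - {w})) \<times> (insert w S \<union> (W - {w}))"
      using Suc.prems(6) e by blast
    ultimately have "Suc (Suc (card (W - {w}))) \<le> card (rooted_edge_sets E (insert w S))"
      using Suc.hyps(1)[OF k[symmetric] Suc.prems(1,2) pre(3,1,2)] Suc.prems(7) by blast
    moreover have "1 \<le> card (rooted_edge_sets ?E S)"
      using Suc.prems(1) by (intro card_rooted_edge_sets_pos) auto
    ultimately show ?thesis using st k Suc.hyps(2) by simp
  qed
qed

text \<open>Since \<open>w\<close> separates no other vertex from the root, deleting
  \<open>sw\<close> leaves \<open>card W - 1\<close> vertices reachable and hence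
  \<open>card W\<close> sets. Summed over all contractions this is 1 + (1 + ... +
  \<open>card W\<close>).\<close>

lemma card_rooted_edge_sets_ge_triangular:
  assumes "finite E" "sym E" "finite W" "W \<inter> S = {}" "W \<subseteq> reach E S"
    and "E \<subseteq> (S \<union> W) \<times> (S \<union> W)" "\<And>x. x \<in> W \<Longrightarrow> W - {x} \<subseteq> reach (avoiding E x) S"
  shows "card W * (card W + 1) + 2 \<le> 2 * card (rooted_edge_sets E S)"
  using assms
proof (induction "card W" arbitrary: W S)
  case 0
  then show ?case using card_rooted_edge_sets_pos[of E S] by simp
next
  case (Suc k)
  then have "W \<noteq> {}" by auto
  obtain s w where e: "s \<in> S" "w \<in> W" "(s, w) \<in> E"
    using reach_step_root[OF \<open>W \<noteq> {}\<close> Suc.prems(4-6)] .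
  then have w: "w \<notin> S" using Suc.prems(4) by blast
  let ?E = "E - {(s, w), (w, s)}"
  have k: "card (W - {w}) = k" using e Suc.hyps(2) Suc.prems(3) by simp
  have mono: "reach E' S \<subseteq> reach E' (insert w S)" for E'
    by (rule reach_mono) auto
  have "card (W - {w}) * (card (W - {w}) + 1) + 2 \<le> 2 * card (rooted_edge_sets E (insert w S))"
  proof (rule Suc.hyps(1)[OF k[symmetric] Suc.prems(1,2)])
    show "W - {w} \<subseteq> reach E (insert w S)" using mono[of E] Suc.prems(5) by blast
    show "E \<subseteq> (insert w S \<union> (W - {w})) \<times> (insert w S \<union> (W - {w}))"
      using Suc.prems(6) e by blast
    show "W - {w} - {x} \<subseteq> reach (avoiding E x) (insert w S)" if "x \<in> W - {w}" for x
      using mono[of "avoiding E x"] Suc.prems(7)[of x] that by blast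
  qed (use Suc.prems(3,4) in auto)
  moreover have "Suc (card (W - {w})) \<le> card (rooted_edge_sets ?E S)"
  proof (rule card_rooted_edge_sets_ge_Suc)
    have "reach (avoiding E w) S \<subseteq> reach ?E S" by (rule reach_mono) (auto simp: avoiding_def)
    then show "W - {w} \<subseteq> reach ?E S" using Suc.prems(7)[OF e(2)] by blast
    show "sym ?E" using Suc.prems(2) by (auto simp: sym_def)
  qed (use Suc.prems in auto)
  moreover note card_rooted_edge_sets_step[OF Suc.prems(1,2) e(1) w e(3)]
  ultimately show ?case unfolding Suc.hyps(2)[symmetric] k by simp
qed


section \<open>The block of the root\<close>

text \<open>With \<open>S\<close> contracted to one vertex, that vertex and \<open>B\<close> form a block, and \<open>D\<close> hangs off it
  at \<open>c\<close>. Contraction may create parallel edges, so \<open>B = {c}\<close> is a genuine case.\<close>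

locale rooted_block =
  fixes E :: "('a \<times> 'a) set" and S B :: "'a set" and c :: 'a and D :: "'a set"
  assumes fin: "finite E" "finite B" "finite D"
    and sym: "sym E"
    and c: "c \<in> B"
    and disj: "B \<inter> S = {}" "D \<inter> S = {}" "B \<inter> D = {}"
    and E_sub: "E \<subseteq> (S \<union> (B \<union> D)) \<times> (S \<union> (B \<union> D))"
    and reach_all: "B \<union> D \<subseteq> reach E S"
    and reach_avoiding: "\<And>x. x \<in> B \<union> D \<Longrightarrow> x \<noteq> c \<Longrightarrow> B \<union> D - {x} \<subseteq> reach (avoiding E x) S"
    and reach_avoiding_c: "B - {c} \<subseteq> reach (avoiding E c) S"
    and conn: "B \<subseteq> reach (Restr E B) {c}"
    and double: "B = {c} \<Longrightarrow> \<exists>s \<in> S. \<exists>t \<in> S. s \<noteq> t \<and> (s, c) \<in> E \<and> (t, c) \<in> E"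
    and D_adj: "\<And>d y. d \<in> D \<Longrightarrow> (d, y) \<in> E \<Longrightarrow> y \<in> insert c D"
begin

lemma D_adj': "d \<in> D \<Longrightarrow> (y, d) \<in> E \<Longrightarrow> y \<in> insert c D"
  using D_adj sym by (auto dest: symD)

lemma neighbour_in_B:
  assumes "a \<in> S" "b \<notin> S" "(a, b) \<in> E"
  shows "b \<in> B"
proof -
  have "b \<in> B \<union> D" using assms E_sub by blast
  moreover have "b \<notin> D" using D_adj'[of b a] assms c disj by blast
  ultimately show ?thesis by blast
qed

lemma reach_Restr_subset: "c \<in> X \<Longrightarrow> reach (Restr E X) {c} \<subseteq> X"
  by (rule reach_least) auto

text \<open>Supplies the vertex that \<open>contract\<close> can absorb: not \<open>c\<close>, which
  carries \<open>D\<close>, and not one whose loss disconnects \<open>B\<close>.\<close>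

lemma non_separating_neighbour:
  assumes "B \<noteq> {c}"
  obtains s w where "s \<in> S" "w \<in> B" "w \<noteq> c" "(s, w) \<in> E"
    "B - {w} \<subseteq> reach (Restr E (B - {w})) {c}"
proof -
  define N where "N = {w \<in> B. w \<noteq> c \<and> (\<exists>s \<in> S. (s, w) \<in> E)}"
  define C where "C w = reach (Restr E (B - {w})) {c}" for w
  have C_sub: "C w \<subseteq> B - {w}" if "w \<noteq> c" for w
    unfolding C_def using that c by (intro reach_Restr_subset) blast
  have cC: "c \<in> C w" for w by (simp add: C_def reach_root)
  have C_step: "b \<in> C w" if "a \<in> C w" "(a, b) \<in> E" "w \<noteq> c" "b \<in> B" "b \<noteq> w" for a b w
  proof -
    have "a \<in> B - {w}" using C_sub that by blast
    then have "(a, b) \<in> Restr E (B - {w})" using that by blast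
    then show ?thesis using that(1) unfolding C_def by (rule reach_step[rotated])
  qed
  \<comment> \<open>Maximise the component of \<open>c\<close> left by deleting a neighbour of the root: a further component would
    contain another such neighbour, whose deletion leaves a larger component.\<close>
  have "finite N" unfolding N_def using fin by simp
  moreover have "N \<noteq> {}"
  proof -
    obtain y where y: "y \<in> B" "y \<noteq> c" using assms c by blast
    then have "y \<in> reach (avoiding E c) S" "y \<notin> S" using reach_avoiding_c disj by blast+
    then obtain a b where "a \<in> S" "b \<notin> S" "(a, b) \<in> avoiding E c"
      using reach_exit[of y "avoiding E c" S S] by blast
    then show ?thesis using neighbour_in_B[of a b] unfolding N_def avoiding_def by blast
  qed
  ultimately have "Max ((\<lambda>w. card (C w)) ` N) \<in> (\<lambda>w. card (C w)) ` N"
    by (intro Max_in) auto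
  then obtain w where w: "w \<in> N" "Max ((\<lambda>w. card (C w)) ` N) = card (C w)" by auto
  have max: "card (C w') \<le> card (C w)" if "w' \<in> N" for w'
    using Max_ge[of "(\<lambda>w. card (C w)) ` N" "card (C w')"] that \<open>finite N\<close> w(2) by auto
  have wB: "w \<in> B" "w \<noteq> c" using w unfolding N_def by blast+
  have "B - {w} \<subseteq> C w"
  proof (rule ccontr)
    assume "\<not> B - {w} \<subseteq> C w"
    then obtain y where y: "y \<in> B" "y \<noteq> w" "y \<notin> C w" by blast
    define K where "K = B - {w} - C w"
    have "y \<in> reach (avoiding E w) S" using y wB reach_avoiding[of w] by blast
    moreover have "S \<subseteq> - K" "y \<notin> - K" using disj y unfolding K_def by blast+
    ultimately obtain a b where ab: "a \<notin> K" "b \<in> K" "(a, b) \<in> avoiding E w"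
      using reach_exit[of y "avoiding E w" S "- K"] by blast
    then have ab': "(a, b) \<in> E" "a \<noteq> w" "b \<noteq> w" "b \<in> B" "b \<notin> C w" "b \<noteq> c"
      using cC[of w] unfolding avoiding_def K_def by blast+
    \<comment> \<open>The set \<open>K\<close> can be entered only from the root: \<open>D\<close>
      touches nothing in \<open>B\<close> but \<open>c\<close>, and \<open>C w\<close> is closed
      under steps inside \<open>B - {w}\<close>.\<close>
    have "a \<notin> D" using D_adj[of a b] ab' disj by blast
    moreover have "a \<notin> B"
      using C_step[OF _ ab'(1) wB(2) ab'(4,3)] ab' ab(1) unfolding K_def by blast
    ultimately have "a \<in> S" using E_sub ab'(1) by blast
    then have bN: "b \<in> N" unfolding N_def using ab' by blast
    have sub: "C w \<subseteq> C b \<inter> C w"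
      unfolding C_def[of w]
    proof (rule reach_least, goal_cases)
      case 1
      then show ?case using cC by (auto simp: C_def[symmetric])
    next
      case (2 u v)
      then have uv: "u \<in> C b" "u \<in> C w" "(u, v) \<in> E" "v \<in> B" "v \<noteq> w"
        unfolding C_def by blast+
      have "v \<in> C w" using C_step[OF uv(2,3) wB(2) uv(4,5)] .
      moreover from this have "v \<in> C b" using C_step[OF uv(1,3) ab'(6) uv(4)] ab'(5) by blast
      ultimately show ?case unfolding C_def by blast
    qed
    \<comment> \<open>Connectedness of \<open>B\<close> gives an arc from \<open>C w\<close> to
      \<open>w\<close>; as \<open>C w\<close> survives the deletion of \<open>b\<close>, so does
      this arc, and \<open>C b\<close> gains \<open>w\<close>.\<close>
    have "w \<in> reach (Restr E B) {c}" using conn wB by blast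
    moreover have "w \<notin> C w" using C_sub wB by blast
    ultimately obtain u v where uv: "u \<in> C w" "v \<notin> C w" "(u, v) \<in> Restr E B"
      using reach_exit[of w "Restr E B" "{c}" "C w"] cC by blast
    then have "v = w" using C_step[of u w v] wB by blast
    then have "w \<in> C b" using C_step[of u b w] uv sub ab' wB by blast
    then have "insert w (C w) \<subseteq> C b" using sub by blast
    moreover have finC: "finite (C b)" "finite (C w)"
      using C_sub[OF ab'(6)] C_sub[OF wB(2)] fin(2) by (meson finite_Diff finite_subset)+
    ultimately have "card (insert w (C w)) \<le> card (C b)" by (intro card_mono)
    then show False using max[OF bN] \<open>w \<notin> C w\<close> finC(2) by simp
  qed
  moreover obtain s where "s \<in> S" "(s, w) \<in> E" using w unfolding N_def by blast
  ultimately show thesis using that wB unfolding C_def by blast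
qed

text \<open>A larger root only enlarges reachable sets, and \<open>con\<close> is assumed, so the
  real work is \<open>double\<close>. When \<open>B = {w, c}\<close>, one edge at \<open>c\<close>
  comes from \<open>w\<close> because \<open>B\<close> is connected, the other from the old root
  because \<open>w\<close> does not separate \<open>c\<close> from it.\<close>

lemma contract:
  assumes s: "s \<in> S" and w: "w \<in> B" "w \<noteq> c" "(s, w) \<in> E"
    and con: "B - {w} \<subseteq> reach (Restr E (B - {w})) {c}"
  shows "rooted_block E (insert w S) (B - {w}) c D"
proof unfold_locales
  have mono: "reach E' S \<subseteq> reach E' (insert w S)" for E'
    by (rule reach_mono) auto
  show "B - {w} \<union> D \<subseteq> reach E (insert w S)" using mono[of E] reach_all by blast
  show "B - {w} \<union> D - {x} \<subseteq> reach (avoiding E x) (insert w S)"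
    if "x \<in> B - {w} \<union> D" "x \<noteq> c" for x
    using reach_avoiding[of x] that mono[of "avoiding E x"] by blast
  show "B - {w} - {c} \<subseteq> reach (avoiding E c) (insert w S)"
    using reach_avoiding_c mono[of "avoiding E c"] by blast
  show "\<exists>s\<in>insert w S. \<exists>t\<in>insert w S. s \<noteq> t \<and> (s, c) \<in> E \<and> (t, c) \<in> E" if "B - {w} = {c}"
  proof -
    have B: "B = {w, c}" using that w by blast
    have "w \<in> reach (Restr E B) {c}" using conn w by blast
    then obtain a b where "a \<in> {c}" "b \<notin> {c}" "(a, b) \<in> Restr E B"
      using reach_exit[of w _ "{c}" "{c}"] w by blast
    then have "(c, w) \<in> E" using B by blast
    then have wc: "(w, c) \<in> E" using sym by (auto dest: symD)
    have "c \<in> reach (avoiding E w) S" using reach_avoiding[of w] w c by blast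
    then obtain a b where ab: "a \<in> S" "b \<notin> S" "(a, b) \<in> avoiding E w"
      using reach_exit[of c _ S S] c disj by blast
    then have "(a, b) \<in> E" "b \<noteq> w" unfolding avoiding_def by blast+
    then have "b = c" using neighbour_in_B[of a b] ab B by blast
    moreover have "a \<noteq> w" using ab(1) w(1) disj(1) by blast
    ultimately show ?thesis using ab(1) wc \<open>(a, b) \<in> E\<close>
      by (intro bexI[of _ a] bexI[of _ w]) auto
  qed
  show "E \<subseteq> (insert w S \<union> (B - {w} \<union> D)) \<times> (insert w S \<union> (B - {w} \<union> D))"
    using E_sub w by blast
  show "B - {w} \<subseteq> reach (Restr E (B - {w})) {c}" by (rule con)
  show "\<And>d y. d \<in> D \<Longrightarrow> (d, y) \<in> E \<Longrightarrow> y \<in> insert c D" by (rule D_adj)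
qed (use fin sym c w disj in auto)

text \<open>Everything but \<open>w\<close> is reached while avoiding \<open>w\<close>, and
  \<open>w\<close> itself through a neighbour in \<open>B\<close>, whose arc is not the deleted
  one.\<close>

lemma reach_delete:
  assumes w: "w \<in> B" "w \<noteq> c" and s: "s \<in> S"
  shows "B \<union> D \<subseteq> reach (E - {(s, w), (w, s)}) S"
proof -
  let ?E = "E - {(s, w), (w, s)}"
  have "reach (avoiding E w) S \<subseteq> reach ?E S" by (rule reach_mono) (auto simp: avoiding_def)
  then have rest: "B \<union> D - {w} \<subseteq> reach ?E S" using reach_avoiding[of w] w by blast
  have "w \<in> reach (Restr E B) {c}" using conn w by blast
  then obtain a b where ab: "a \<in> - {w}" "b \<notin> - {w}" "(a, b) \<in> Restr E B"
    using reach_exit[of w _ "{c}" "- {w}"] w by blast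
  then have "(a, w) \<in> ?E" "a \<in> B \<union> D - {w}" using s disj(1) by blast+
  then have "w \<in> reach ?E S" using rest reach_step[of a ?E S w] by blast
  with rest show ?thesis by blast
qed

text \<open>The induction step for both block bounds. After deletion all of
  \<open>B \<union> D\<close> is still reachable, which yields
  \<open>Suc (card (B \<union> D))\<close> sets. The \<open>+ 2\<close> in the strict version
  accounts for the two arcs of the deleted edge.\<close>

lemma step_bound:
  assumes "B \<noteq> {c}"
  obtains w where "w \<in> B" "w \<noteq> c" "rooted_block E (insert w S) (B - {w}) c D"
    "card (rooted_edge_sets E (insert w S)) + Suc (card (B \<union> D)) \<le> card (rooted_edge_sets E S)"
    "irrefl E \<Longrightarrow> card (E - S \<times> S) > 2 * card (B \<union> D) + 2 \<Longrightarrow>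
      card (rooted_edge_sets E (insert w S)) + Suc (card (B \<union> D)) < card (rooted_edge_sets E S)"
proof -
  obtain s w where sw: "s \<in> S" "w \<in> B" "w \<noteq> c" "(s, w) \<in> E"
    "B - {w} \<subseteq> reach (Restr E (B - {w})) {c}"
    using non_separating_neighbour[OF assms] .
  let ?E = "E - {(s, w), (w, s)}"
  have w: "w \<notin> S" using sw disj by blast
  have pre: "finite ?E" "sym ?E" "finite (B \<union> D)" "(B \<union> D) \<inter> S = {}" "B \<union> D \<subseteq> reach ?E S"
    using fin sym disj reach_delete[OF sw(2,3,1)] by (auto simp: sym_def)
  note st = card_rooted_edge_sets_step[OF fin(1) sym sw(1) w sw(4)]
  show thesis
  proof (rule that[OF sw(2,3) contract[OF sw]])
    show "card (rooted_edge_sets E (insert w S)) + Suc (card (B \<union> D)) \<le> card (rooted_edge_sets E S)"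
      using card_rooted_edge_sets_ge_Suc[OF pre] st by linarith
    assume irr: "irrefl E" and big: "card (E - S \<times> S) > 2 * card (B \<union> D) + 2"
    have "E - S \<times> S \<subseteq> (?E - S \<times> S) \<union> {(s, w), (w, s)}" by blast
    then have "card (E - S \<times> S) \<le> card ((?E - S \<times> S) \<union> {(s, w), (w, s)})"
      using fin(1) by (intro card_mono) auto
    also have "\<dots> \<le> card (?E - S \<times> S) + card {(s, w), (w, s)}"
      by (rule card_Un_le)
    also have "\<dots> \<le> card (?E - S \<times> S) + 2"
      by (rule add_left_mono, rule order_trans[OF card_insert_le_m1[of 2]]) auto
    finally have "card (?E - S \<times> S) > 2 * card (B \<union> D)" using big by linarith
    moreover have "irrefl ?E" using irr by (auto simp: irrefl_def)
    moreover have "?E \<subseteq> (S \<union> (B \<union> D)) \<times> (S \<union> (B \<union> D))" using E_sub by blast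
    ultimately show
      "card (rooted_edge_sets E (insert w S)) + Suc (card (B \<union> D)) < card (rooted_edge_sets E S)"
      using card_rooted_edge_sets_ge_Suc_Suc[OF pre] st by linarith
  qed
qed

text \<open>Two parallel edges between the root and \<open>c\<close> have three nonempty subsets,
  each compatible with every choice in \<open>D\<close> rooted at \<open>c\<close>; the empty set
  adds one. With d for \<open>card D\<close> this is 3(d(d+1)/2 + 1) + 1, doubled in the
  statement.\<close>

lemma base_bound:
  assumes "B = {c}"
  shows "3 * card D * (card D + 1) + 8 \<le> 2 * card (rooted_edge_sets E S)"
proof -
  obtain s t where st: "s \<in> S" "t \<in> S" "s \<noteq> t" "(s, c) \<in> E" "(t, c) \<in> E"
    using double[OF assms] by blast
  then have st': "(c, s) \<in> E" "(c, t) \<in> E" using sym by (auto dest: symD)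
  have cS: "c \<notin> S" using c disj by blast
  let ?E = "E - {(s, c), (c, s)}" and ?R = "rooted_edge_sets E (insert c S)"
  \<comment> \<open>Once \<open>c\<close> belongs to the root, the edge \<open>sc\<close> is a loop
    that no set can use, so its deletion costs nothing.\<close>
  have sub: "?R \<subseteq> rooted_edge_sets ?E (insert c S)"
  proof
    fix F assume F: "F \<in> ?R"
    then have "(s, c) \<notin> F" "(c, s) \<notin> F" using st(1) unfolding rooted_edge_sets_def by blast+
    with F show "F \<in> rooted_edge_sets ?E (insert c S)" unfolding rooted_edge_sets_def by blast
  qed
  have symE: "sym ?E" using sym by (auto simp: sym_def)
  have "card ?R \<le> card (rooted_edge_sets ?E (insert c S))"
    by (rule card_mono[OF finite_rooted_edge_sets sub]) (use fin in auto)
  moreover have "card (rooted_edge_sets ?E (insert c S))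
      + card (rooted_edge_sets (?E - {(t, c), (c, t)}) S) \<le> card (rooted_edge_sets ?E S)"
    by (rule card_rooted_edge_sets_step) (use st fin symE cS in auto)
  moreover have "1 \<le> card (rooted_edge_sets (?E - {(t, c), (c, t)}) S)"
    by (rule card_rooted_edge_sets_pos) (use fin in auto)
  moreover have "card {{(s, c), (c, s)}, {(s, c), (c, s), (t, c), (c, t)}} * card ?R
      + card (rooted_edge_sets ?E S) \<le> card (rooted_edge_sets E S)"
    by (rule card_rooted_edge_sets_contract_delete)
      (use st st' fin sym cS in \<open>auto simp: sym_def\<close>)
  moreover have "card {{(s, c), (c, s)}, {(s, c), (c, s), (t, c), (c, t)}} = 2"
  proof -
    have neq: "{(s, c), (c, s)} \<noteq> {(s, c), (c, s), (t, c), (c, t)}"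
    proof
      assume "{(s, c), (c, s)} = {(s, c), (c, s), (t, c), (c, t)}"
      then have "(t, c) \<in> {(s, c), (c, s)}" by simp
      then show False using st cS by auto
    qed
    have "card {X, Y} = 2" if "X \<noteq> Y" for X Y :: "('a \<times> 'a) set"
      using that by simp
    from this[OF neq] show ?thesis .
  qed
  moreover have "card D * (card D + 1) + 2 \<le> 2 * card ?R"
  proof (rule card_rooted_edge_sets_ge_triangular)
    have mono: "reach E' S \<subseteq> reach E' (insert c S)" for E' by (rule reach_mono) auto
    show "D \<subseteq> reach E (insert c S)" using mono[of E] reach_all by blast
    show "D - {x} \<subseteq> reach (avoiding E x) (insert c S)" if "x \<in> D" for x
      using that reach_avoiding[of x] mono[of "avoiding E x"] assms disj by blast
    show "E \<subseteq> (insert c S \<union> D) \<times> (insert c S \<union> D)" using E_sub assms by blast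
    show "D \<inter> insert c S = {}" using disj assms by blast
  qed (use fin sym in auto)
  ultimately show ?thesis by (simp add: algebra_simps)
qed

end

text \<open>The value of \<open>base_bound\<close> plus the contributions of \<open>i\<close>
  applications of \<open>step_bound\<close>. For empty \<open>D\<close> the left side is
  \<open>(i + 2) * (i + 3) + 2\<close>, the doubled cycle value on \<open>i + 2\<close>
  vertices.\<close>

lemma rooted_block_bound:
  assumes "rooted_block E S B c D" "card B = Suc i"
  shows "3 * card D * (card D + 1) + 6 + 2 * i * (card D + 1) + (i + 1) * (i + 2)
    \<le> 2 * card (rooted_edge_sets E S)"
  using assms
proof (induction i arbitrary: S B)
  case 0
  interpret rooted_block E S B c D by fact
  have "B = {c}" using c 0(2) by (metis One_nat_def card_1_singletonE singletonD)
  from base_bound[OF this] show ?case by simp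
next
  case (Suc i)
  interpret rooted_block E S B c D by fact
  have "B \<noteq> {c}" using Suc.prems(2) by auto
  then obtain w where w: "w \<in> B" "w \<noteq> c" "rooted_block E (insert w S) (B - {w}) c D"
    "card (rooted_edge_sets E (insert w S)) + Suc (card (B \<union> D)) \<le> card (rooted_edge_sets E S)"
    by (rule step_bound)
  have "card (B - {w}) = Suc i" using w Suc.prems fin by simp
  from Suc.IH[OF w(3) this] w(4) show ?case
    using card_Un_disjoint[OF fin(2,3) disj(3)] Suc.prems(2) by (simp add: algebra_simps)
qed

text \<open>A cycle through the root and \<open>B\<close> has \<open>card B + 1\<close> edges. Any
  more make the first application of \<open>step_bound\<close> strict, and
  \<open>card B \<ge> 2\<close> ensures that there is one.\<close>

lemma rooted_block_bound_strict:
  assumes "rooted_block E S B c {}" "card B = Suc (Suc i)" "irrefl E"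
    "card (E - S \<times> S) > 2 * card B + 2"
  shows "(card B + 1) * (card B + 2) + 2 < 2 * card (rooted_edge_sets E S)"
proof -
  interpret rooted_block E S B c "{}" by fact
  have "B \<noteq> {c}" using assms(2) by auto
  then obtain w where w: "w \<in> B" "w \<noteq> c" "rooted_block E (insert w S) (B - {w}) c {}"
    "card (rooted_edge_sets E (insert w S)) + Suc (card (B \<union> {})) < card (rooted_edge_sets E S)"
    by (rule step_bound) (use assms(3,4) in simp)
  have "card (B - {w}) = Suc i" using w assms fin by simp
  from rooted_block_bound[OF w(3) this] w(4) show ?thesis
    using assms(2) by (simp add: algebra_simps)
qed


section \<open>Cut vertices at the root\<close>

locale single_rooted =
  fixes E :: "('a \<times> 'a) set" and c :: 'a and W :: "'a set"
  assumes fin: "finite E" "finite W"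
    and sym: "sym E" and irrefl: "irrefl E"
    and c: "c \<notin> W"
    and E_sub: "E \<subseteq> insert c W \<times> insert c W"
    and reach_all: "W \<subseteq> reach E {c}"
    and reach_avoiding: "\<And>x. x \<in> W \<Longrightarrow> W - {x} \<subseteq> reach (avoiding E x) {c}"
begin

lemma triangular_bound: "card W * (card W + 1) + 2 \<le> 2 * card (rooted_edge_sets E {c})"
  by (rule card_rooted_edge_sets_ge_triangular)
    (use fin sym c E_sub reach_all reach_avoiding in auto)

lemma connected_rooted_block:
  assumes "w \<in> W" "W \<noteq> {w}" "W \<subseteq> reach (Restr E W) {w}"
  shows "rooted_block E {c} W w {}"
  by unfold_locales (use fin sym c E_sub reach_all reach_avoiding assms in auto)

lemma connected_bound:
  assumes "w \<in> W" "W \<noteq> {w}" "W \<subseteq> reach (Restr E W) {w}"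
  shows "(card W + 1) * (card W + 2) + 2 \<le> 2 * card (rooted_edge_sets E {c})"
proof -
  have "card W \<noteq> 0" using assms fin by auto
  then obtain i where i: "card W = Suc i" using not0_implies_Suc by blast
  from rooted_block_bound[OF connected_rooted_block[OF assms] this] i
  show ?thesis by (simp add: algebra_simps)
qed

text \<open>A path from \<open>c\<close> into \<open>A\<close> may wander through
  \<open>W - A\<close> but can re-enter \<open>A\<close> only from \<open>c\<close>. Hence the
  invariant sets \<open>?T\<close> below admit all of \<open>W - A\<close>.\<close>

lemma part:
  assumes A: "A \<subseteq> W" and sep: "E \<inter> A \<times> (W - A) = {}"
  shows "single_rooted (Restr E (insert c A)) c A"
proof
  let ?E = "Restr E (insert c A)"
  have sep': "a \<notin> A" if "(a, b) \<in> E" "b \<in> W - A" for a b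
    using sep that by blast
  have sep'': "a \<notin> W - A" if "(a, b) \<in> E" "b \<in> A" for a b
    using sep symD[OF sym that(1)] that by blast
  show "A \<subseteq> reach ?E {c}"
  proof
    fix y assume y: "y \<in> A"
    let ?T = "reach ?E {c} \<union> (W - A)"
    have "reach E {c} \<subseteq> ?T"
    proof (rule reach_least)
      show "{c} \<subseteq> ?T" using reach_root[of c "{c}" ?E] by blast
      fix a b assume ab: "a \<in> ?T" "(a, b) \<in> E"
      show "b \<in> ?T"
      proof (cases "b \<in> A")
        case True
        have "reach ?E {c} \<subseteq> insert c A" by (rule reach_least) blast+
        then have "(a, b) \<in> ?E" "a \<in> reach ?E {c}" using ab True sep''[OF ab(2) True] by blast+
        then show ?thesis using reach_step[of a ?E "{c}" b] by blast
      next
        case False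
        then show ?thesis using ab(2) E_sub reach_root[of c "{c}" ?E] by blast
      qed
    qed
    then show "y \<in> reach ?E {c}" using reach_all y A by blast
  qed
  fix x assume x: "x \<in> A"
  then have xc: "c \<noteq> x" using c A by blast
  let ?F = "avoiding ?E x"
  show "A - {x} \<subseteq> reach ?F {c}"
  proof
    fix y assume y: "y \<in> A - {x}"
    let ?T = "reach ?F {c} \<union> (W - A)"
    have "reach (avoiding E x) {c} \<subseteq> ?T"
    proof (rule reach_least)
      show "{c} \<subseteq> ?T" using reach_root[of c "{c}" ?F] by blast
      fix a b assume ab: "a \<in> ?T" "(a, b) \<in> avoiding E x"
      then have ab': "(a, b) \<in> E" "a \<noteq> x" "b \<noteq> x" unfolding avoiding_def by blast+
      show "b \<in> ?T"
      proof (cases "b \<in> A")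
        case True
        have "reach ?F {c} \<subseteq> insert c A" by (rule reach_least) (auto simp: avoiding_def)
        then have "(a, b) \<in> ?E" "a \<in> reach ?F {c}" using ab(1) ab' True sep''[OF ab'(1) True] by blast+
        moreover from this have "(a, b) \<in> ?F" using ab' unfolding avoiding_def by blast
        ultimately show ?thesis using reach_step[of a ?F "{c}" b] by blast
      next
        case False
        then show ?thesis using ab'(1) E_sub reach_root[of c "{c}" ?F] by blast
      qed
    qed
    then show "y \<in> reach ?F {c}" using reach_avoiding[of x] x y A by blast
  qed
qed (use fin sym irrefl c A in \<open>auto simp: sym_def irrefl_def intro: finite_subset\<close>)

text \<open>Choices on the two sides are independent: the two arc sets could share only a loop at
  \<open>c\<close>, and there is none.\<close>

lemma product_bound:
  assumes A: "A \<subseteq> W"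
  shows "card (rooted_edge_sets (Restr E (insert c A)) {c})
    * card (rooted_edge_sets (Restr E (insert c (W - A))) {c}) \<le> card (rooted_edge_sets E {c})"
proof -
  let ?X = "Restr E (insert c A)" and ?Y = "Restr E (insert c (W - A))"
  let ?P = "rooted_edge_sets ?X {c} \<times> rooted_edge_sets ?Y {c}"
  let ?g = "\<lambda>(F, F'). F \<union> F'"
  have XY: "?X \<inter> ?Y = {}" using irrefl c A unfolding irrefl_def by blast
  have inj: "inj_on ?g ?P"
  proof (rule inj_onI, clarify)
    fix F F' H H' assume *: "F \<in> rooted_edge_sets ?X {c}" "F' \<in> rooted_edge_sets ?Y {c}"
      "H \<in> rooted_edge_sets ?X {c}" "H' \<in> rooted_edge_sets ?Y {c}" "F \<union> F' = H \<union> H'"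
    then have sub: "F \<subseteq> ?X" "H \<subseteq> ?X" "F' \<subseteq> ?Y" "H' \<subseteq> ?Y"
      unfolding rooted_edge_sets_def by simp_all
    have rec: "P = (P \<union> Q) \<inter> X \<and> Q = (P \<union> Q) \<inter> Y" if "P \<subseteq> X" "Q \<subseteq> Y" "X \<inter> Y = {}"
      for P Q X Y :: "('a \<times> 'a) set"
      using that by blast
    show "F = H \<and> F' = H'"
      using rec[OF sub(1,3) XY] rec[OF sub(2,4) XY] *(5) by metis
  qed
  have img: "?g ` ?P \<subseteq> rooted_edge_sets E {c}"
  proof (rule image_subsetI, clarify)
    fix F F' assume *: "F \<in> rooted_edge_sets ?X {c}" "F' \<in> rooted_edge_sets ?Y {c}"
    then have F: "F \<subseteq> E" "sym F" "F \<inter> {c} \<times> {c} = {}" "Domain F \<subseteq> reach F {c}"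
      and F': "F' \<subseteq> E" "sym F'" "F' \<inter> {c} \<times> {c} = {}" "Domain F' \<subseteq> reach F' {c}"
      by (simp_all add: rooted_edge_sets_def)
    have "reach F {c} \<subseteq> reach (F \<union> F') {c}" "reach F' {c} \<subseteq> reach (F \<union> F') {c}"
      by (rule reach_mono; blast)+
    then have "Domain (F \<union> F') \<subseteq> reach (F \<union> F') {c}"
      using F(4) F'(4) by (simp add: Domain_Un_eq) blast
    moreover have "(F \<union> F') \<inter> {c} \<times> {c} = {}" using F(3) F'(3) by (simp add: Int_Un_distrib2)
    ultimately show "F \<union> F' \<in> rooted_edge_sets E {c}"
      using F(1,2) F'(1,2) by (simp add: rooted_edge_sets_def sym_Un)
  qed
  have "card ?P \<le> card (rooted_edge_sets E {c})"
    by (rule card_inj_on_le[OF inj img finite_rooted_edge_sets[OF fin(1)]])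
  then show ?thesis by (simp only: card_cartesian_product)
qed

lemma split_bound:
  assumes A: "A \<subseteq> W" and sep: "E \<inter> A \<times> (W - A) = {}"
  shows "(card A * (card A + 1) + 2) * (card (W - A) * (card (W - A) + 1) + 2)
    \<le> 4 * card (rooted_edge_sets E {c})"
proof -
  have sep': "E \<inter> (W - A) \<times> (W - (W - A)) = {}" using sep A sym by (auto dest: symD)
  interpret X: single_rooted "Restr E (insert c A)" c A by (rule part[OF A sep])
  interpret Y: single_rooted "Restr E (insert c (W - A))" c "W - A"
    by (rule part[OF _ sep']) blast
  from mult_le_mono[OF X.triangular_bound Y.triangular_bound] product_bound[OF A]
  show ?thesis by simp
qed

lemma disconnected_split:
  assumes "w \<in> W" "\<not> W \<subseteq> reach (Restr E W) {w}"
  obtains A where "A \<subseteq> W" "A \<noteq> {}" "W - A \<noteq> {}" "E \<inter> A \<times> (W - A) = {}"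
proof
  let ?A = "reach (Restr E W) {w}"
  show sub: "?A \<subseteq> W" by (rule reach_least) (use assms in auto)
  show "?A \<noteq> {}" using reach_root[of w "{w}"] by blast
  show "W - ?A \<noteq> {}" using assms by blast
  show "E \<inter> ?A \<times> (W - ?A) = {}"
  proof (rule equals0I, clarify)
    fix a b assume "(a, b) \<in> E" "a \<in> ?A" "b \<in> W" "b \<notin> ?A"
    moreover from this have "(a, b) \<in> Restr E W" using sub by blast
    ultimately show False using reach_step[of a "Restr E W" "{w}" b] by blast
  qed
qed

text \<open>The triangular bound gives only 11 here. In \<open>leaf_split_bound\<close> with five
  vertices, 2 * 11 would merely tie with the cycle value 22, so one more is required.\<close>

lemma four_bound:
  assumes "card W = 4"
  shows "12 \<le> card (rooted_edge_sets E {c})"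
proof -
  obtain w where w: "w \<in> W" using assms by fastforce
  have "W \<noteq> {w}" using assms by auto
  show ?thesis
  proof (cases "W \<subseteq> reach (Restr E W) {w}")
    case True
    from connected_bound[OF w \<open>W \<noteq> {w}\<close> this] assms show ?thesis by simp
  next
    case False
    then obtain A where A: "A \<subseteq> W" "A \<noteq> {}" "W - A \<noteq> {}" "E \<inter> A \<times> (W - A) = {}"
      using disconnected_split w by blast
    have finA: "finite A" using A fin finite_subset by blast
    have "card (W - A) = 4 - card A" using assms A finA by (simp add: card_Diff_subset)
    moreover have "card A \<noteq> 0" "card (W - A) \<noteq> 0" using A finA fin by auto
    ultimately have "card A \<in> {1, 2, 3}" "card (W - A) = 4 - card A" by auto
    then show ?thesis using split_bound[OF A(1,4)] by auto
  qed
qed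

end

text \<open>For \<open>a = b = 2\<close> both sides equal 64, so a sum of at least five is
  needed.\<close>

lemma triangular_product_gt:
  fixes a b :: nat
  assumes "2 \<le> a" "2 \<le> b" "5 \<le> a + b"
  shows "2 * ((a + b + 1) * (a + b + 2)) + 4 < (a * (a + 1) + 2) * (b * (b + 1) + 2)"
proof -
  have *: "2 * ((a + b + 1) * (a + b + 2)) + 4 < (a * (a + 1) + 2) * (b * (b + 1) + 2)"
    if "2 \<le> a" "3 \<le> b" for a b :: nat
  proof -
    \<comment> \<open>In these offsets the difference of the two sides is a polynomial with
      nonnegative coefficients and positive constant term.\<close>
    define x y where "x = a - 2" and "y = b - 3"
    then have "a = 2 + x" "b = 3 + y" using that by simp_all
    then show ?thesis by (simp add: algebra_simps)
  qed
  show ?thesis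
  proof (cases "3 \<le> b")
    case True
    then show ?thesis using *[of a b] assms by blast
  next
    case False
    then show ?thesis using *[of b a] assms by (simp add: algebra_simps)
  qed
qed

text \<open>A one-vertex side contributes the factor 2. With b vertices on the other side, the
  triangular bound exceeds the cycle value exactly when (b - 4)(b + 1) > 0; the tie at b = 4 is left
  to \<open>four_bound\<close>.\<close>

lemma (in single_rooted) leaf_split_bound:
  assumes A: "A \<subseteq> W" "card A = 1" and sep: "E \<inter> A \<times> (W - A) = {}" and W: "5 \<le> card W"
  shows "(card W + 1) * (card W + 2) + 2 < 2 * card (rooted_edge_sets E {c})"
proof -
  let ?b = "card (W - A)"
  have "finite A" using A fin finite_subset by blast
  then have W': "card W = Suc ?b" using A W by (simp add: card_Diff_subset)
  have sep': "E \<inter> (W - A) \<times> (W - (W - A)) = {}" using sep A sym by (auto dest: symD)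
  interpret X: single_rooted "Restr E (insert c A)" c A by (rule part[OF A(1) sep])
  interpret Y: single_rooted "Restr E (insert c (W - A))" c "W - A"
    by (rule part[OF _ sep']) blast
  show ?thesis
  proof (cases "?b = 4")
    case True
    have "2 \<le> card (rooted_edge_sets (Restr E (insert c A)) {c})"
      using X.triangular_bound A by simp
    from mult_le_mono[OF this Y.four_bound[OF True]] product_bound[OF A(1)]
    show ?thesis using True W' by simp
  next
    case False
    then have "5 \<le> ?b" using W W' by simp
    then obtain y where "?b = 5 + y" using le_Suc_ex by metis
    then show ?thesis using split_bound[OF A(1) sep] A(2) W' by (simp add: algebra_simps)
  qed
qed

text \<open>Applied twice: to the whole graph rooted at its cut vertex, and to the graph without a
  pendant vertex, to show that its neighbour no longer separates.\<close>

lemma (in single_rooted) cut_root_bound: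
  assumes A: "A \<subseteq> W" "A \<noteq> {}" "W - A \<noteq> {}" and sep: "E \<inter> A \<times> (W - A) = {}"
    and W: "5 \<le> card W"
  shows "(card W + 1) * (card W + 2) + 2 < 2 * card (rooted_edge_sets E {c})"
proof -
  have "finite A" using A fin finite_subset by blast
  then have W': "card W = card A + card (W - A)"
    using A(1) fin by (simp add: card_Diff_subset card_mono)
  have sep': "E \<inter> (W - A) \<times> (W - (W - A)) = {}" using sep A sym by (auto dest: symD)
  have "card A \<noteq> 0" "card (W - A) \<noteq> 0" using A \<open>finite A\<close> fin by auto
  then consider "card A = 1" | "card (W - A) = 1" | "2 \<le> card A" "2 \<le> card (W - A)" by linarith
  then show ?thesis
  proof cases
    case 1
    then show ?thesis using leaf_split_bound[OF A(1) _ sep W] by blast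
  next
    case 2
    then show ?thesis using leaf_split_bound[OF _ _ sep' W] by blast
  next
    case 3
    then show ?thesis
      using triangular_product_gt[OF 3] split_bound[OF A(1) sep] W W' by simp
  qed
qed


section \<open>Graphs with a unique cut vertex\<close>

locale unique_cut =
  fixes E :: "('a \<times> 'a) set" and V :: "'a set" and c :: 'a
  assumes fin: "finite V" and sym: "sym E" and irrefl: "irrefl E" and E_sub: "E \<subseteq> V \<times> V"
    and c: "c \<in> V"
    and conn: "\<And>x. x \<in> V \<Longrightarrow> V \<subseteq> reach E {x}"
    and nonsep: "\<And>x r. x \<in> V \<Longrightarrow> x \<noteq> c \<Longrightarrow> r \<in> V - {x} \<Longrightarrow> V - {x} \<subseteq> reach (avoiding E x) {r}"
    and sep: "\<exists>u \<in> V - {c}. \<not> V - {c} \<subseteq> reach (avoiding E c) {u}"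
    and V_ge: "7 \<le> card V"
begin

lemma fin_E: "finite E"
  using E_sub fin by (meson finite_SigmaI finite_subset)

lemma bound_at_cut: "card V * (card V - 1) + 4 < 2 * card (rooted_edge_sets E {c})"
proof -
  let ?W = "V - {c}"
  interpret R: single_rooted E c ?W
  proof
    show "?W - {x} \<subseteq> reach (avoiding E x) {c}" if "x \<in> ?W" for x
      using nonsep[of x c] that c by blast
  qed (use fin_E fin sym irrefl E_sub c conn[OF c] in auto)
  obtain u where u: "u \<in> ?W" "\<not> ?W \<subseteq> reach (avoiding E c) {u}" using sep by blast
  have "reach (Restr E ?W) {u} \<subseteq> reach (avoiding E c) {u}"
    by (rule reach_mono) (auto simp: avoiding_def)
  with u have "\<not> ?W \<subseteq> reach (Restr E ?W) {u}" by blast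
  from R.disconnected_split[OF u(1) this] obtain A where
    "A \<subseteq> ?W" "A \<noteq> {}" "?W - A \<noteq> {}" "E \<inter> A \<times> (?W - A) = {}" .
  then have "(card ?W + 1) * (card ?W + 2) + 2 < 2 * card (rooted_edge_sets E {c})"
    using V_ge c fin by (intro R.cut_root_bound) auto
  moreover obtain m where "card V = Suc m" using V_ge by (cases "card V") auto
  ultimately show ?thesis using c fin V_ge by (simp add: algebra_simps)
qed

text \<open>Here \<open>B\<close> consists of \<open>c\<close> and the component \<open>K\<close> of
  \<open>v\<close> in the graph without \<open>c\<close>, less \<open>v\<close> itself;
  \<open>D\<close> collects all other components, which touch only \<open>c\<close>.\<close>

lemma bound_in_block:
  assumes v: "v \<in> V" "v \<noteq> c" and K: "reach (avoiding E c) {v} \<noteq> {v}"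
  shows "card V * (card V - 1) + 4 < 2 * card (rooted_edge_sets E {v})"
proof -
  define K where "K = reach (avoiding E c) {v}"
  define B where "B = insert c (K - {v})"
  define D where "D = V - K - {c}"
  have vK: "v \<in> K" unfolding K_def by (rule reach_root) simp
  have KV: "K \<subseteq> V - {c}"
    unfolding K_def by (rule reach_least) (use v E_sub in \<open>auto simp: avoiding_def\<close>)
  have K_step: "b \<in> K" if "a \<in> K" "(a, b) \<in> E" "b \<noteq> c" for a b
  proof -
    have "a \<noteq> c" using that KV by blast
    then have "(a, b) \<in> avoiding E c" using that unfolding avoiding_def by blast
    with that(1) show ?thesis unfolding K_def by (rule reach_step)
  qed
  have BD: "B \<union> D = V - {v}" using KV vK v c unfolding B_def D_def by blast
  have D_adj: "y \<in> insert c D" if "d \<in> D" "(d, y) \<in> E" for d y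
  proof -
    have "(y, d) \<in> E" using that(2) sym by (auto dest: symD)
    moreover have "d \<notin> K" "d \<noteq> c" "y \<in> V" using that E_sub unfolding D_def by blast+
    ultimately show ?thesis using K_step[of y d] unfolding D_def by blast
  qed
  have "rooted_block E {v} B c D"
  proof
    show "B \<union> D \<subseteq> reach E {v}" using conn[OF v(1)] BD by blast
    show "B \<union> D - {x} \<subseteq> reach (avoiding E x) {v}" if "x \<in> B \<union> D" "x \<noteq> c" for x
      using nonsep[of x v] that v BD by blast
    show "B - {c} \<subseteq> reach (avoiding E c) {v}" unfolding B_def K_def by blast
    show "B \<subseteq> reach (Restr E B) {c}"
    proof
      fix y assume y: "y \<in> B"
      \<comment> \<open>Since \<open>v\<close> does not separate, every vertex of \<open>B\<close>
        is reached from \<open>c\<close> avoiding \<open>v\<close>; detours into \<open>D\<close>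
        return to \<open>c\<close> and can be cut out.\<close>
      let ?T = "reach (Restr E B) {c} \<union> D"
      have cT: "c \<in> reach (Restr E B) {c}" by (rule reach_root) simp
      have "reach (avoiding E v) {c} \<subseteq> ?T"
      proof (rule reach_least)
        show "{c} \<subseteq> ?T" using cT by blast
        fix a b assume ab: "a \<in> ?T" "(a, b) \<in> avoiding E v"
        then have ab': "(a, b) \<in> E" "b \<in> V - {v}" using E_sub unfolding avoiding_def by blast+
        show "b \<in> ?T"
        proof (cases "b \<in> D \<or> b = c")
          case True
          then show ?thesis using cT by blast
        next
          case False
          then have "b \<in> B" "a \<notin> D" using BD ab' D_adj[of a b] by blast+
          moreover have "reach (Restr E B) {c} \<subseteq> B"
            by (rule reach_least) (auto simp: B_def)
          ultimately have "(a, b) \<in> Restr E B" "a \<in> reach (Restr E B) {c}" using ab ab' by blast+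
          then show ?thesis using reach_step[of a "Restr E B" "{c}" b] by blast
        qed
      qed
      moreover have "y \<in> reach (avoiding E v) {c}"
        using nonsep[of v c] v c y KV BD by blast
      moreover have "y \<notin> D" using y unfolding B_def D_def by blast
      ultimately show "y \<in> reach (Restr E B) {c}" by blast
    qed
    have "B \<noteq> {c}" using K vK KV unfolding B_def K_def by blast
    then show "B = {c} \<Longrightarrow> \<exists>s\<in>{v}. \<exists>t\<in>{v}. s \<noteq> t \<and> (s, c) \<in> E \<and> (t, c) \<in> E" by blast
    show "E \<subseteq> ({v} \<union> (B \<union> D)) \<times> ({v} \<union> (B \<union> D))" unfolding BD using E_sub by blast
    show "finite B" "finite D" using fin BD by (metis finite_Diff finite_Un)+
    show "B \<inter> {v} = {}" "D \<inter> {v} = {}" "B \<inter> D = {}" "c \<in> B"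
      using v vK unfolding B_def D_def by blast+
    show "\<And>d y. d \<in> D \<Longrightarrow> (d, y) \<in> E \<Longrightarrow> y \<in> insert c D" by (rule D_adj)
  qed (rule fin_E sym)+
  then interpret R: rooted_block E "{v}" B c D .
  obtain i where i: "card B = Suc i" using R.c R.fin(2) by (cases "card B") auto
  have "card V - 1 = card (V - {v})" using v fin by simp
  also have "\<dots> = Suc i + card D"
    unfolding BD[symmetric] using card_Un_disjoint[OF R.fin(2,3) R.disj(3)] i by simp
  finally have "card V = Suc (Suc i + card D)" using V_ge by simp
  \<comment> \<open>Half the difference between the bound of \<open>rooted_block_bound\<close> and
    the value to beat.\<close>
  moreover have "0 < card D * card D + i + 1" by simp
  ultimately show ?thesis
    using rooted_block_bound[OF R.rooted_block_axioms i] by (simp add: algebra_simps)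
qed

section \<open>A root that is isolated by removing the cut vertex\<close>

context
  fixes v assumes v: "v \<in> V" "v \<noteq> c" and K: "reach (avoiding E c) {v} = {v}"
begin

lemma pendant_adj: "(v, y) \<in> E \<longleftrightarrow> y = c"
proof
  assume vy: "(v, y) \<in> E"
  show "y = c"
  proof (rule ccontr)
    assume "y \<noteq> c"
    then have "(v, y) \<in> avoiding E c" using vy v unfolding avoiding_def by blast
    then have "y \<in> reach (avoiding E c) {v}" using reach_step[OF reach_root[of v "{v}"]] by simp
    then have "y = v" unfolding K by blast
    then show False using vy irrefl unfolding irrefl_def by blast
  qed
next
  assume y: "y = c"
  have "c \<in> reach E {v}" using conn[OF v(1)] c by blast
  then obtain a b where "a \<in> {v}" "b \<notin> {v}" "(a, b) \<in> E"
    using reach_exit[of c E "{v}" "{v}"] v by blast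
  then have vb: "(v, b) \<in> E" "b \<noteq> v" by blast+
  have "b = c"
  proof (rule ccontr)
    assume "b \<noteq> c"
    then have "(v, b) \<in> avoiding E c" using vb v unfolding avoiding_def by blast
    then have "b \<in> reach (avoiding E c) {v}" using reach_step[OF reach_root[of v "{v}"]] by simp
    then show False using vb unfolding K by blast
  qed
  then show "(v, y) \<in> E" using vb y by blast
qed

text \<open>A walk through \<open>v\<close> enters and leaves it by \<open>c\<close>, so dropping
  \<open>v\<close> destroys no connection from \<open>c\<close>.\<close>

lemma rest_single_rooted: "single_rooted (avoiding E v) c (V - {v, c})"
proof
  show "V - {v, c} \<subseteq> reach (avoiding E v) {c}" using nonsep[of v c] v c by blast
  fix x assume x: "x \<in> V - {v, c}"
  let ?F = "avoiding (avoiding E v) x"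
  have cF: "c \<in> reach ?F {c}" by (rule reach_root) simp
  have "reach (avoiding E x) {c} \<subseteq> insert v (reach ?F {c})"
  proof (rule reach_least)
    show "{c} \<subseteq> insert v (reach ?F {c})" using cF by blast
    fix a b assume ab: "a \<in> insert v (reach ?F {c})" "(a, b) \<in> avoiding E x"
    then have ab': "(a, b) \<in> E" unfolding avoiding_def by blast
    show "b \<in> insert v (reach ?F {c})"
    proof (cases "a = v \<or> b = v")
      case True
      then show ?thesis using ab' pendant_adj[of b] cF by blast
    next
      case False
      then have "(a, b) \<in> ?F" "a \<in> reach ?F {c}" using ab unfolding avoiding_def by blast+
      then show ?thesis using reach_step[of a ?F "{c}" b] by blast
    qed
  qed
  moreover have "V - {x} \<subseteq> reach (avoiding E x) {c}" using nonsep[of x c] x c by blast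
  ultimately show "V - {v, c} - {x} \<subseteq> reach ?F {c}" by blast
qed (use fin_E fin sym irrefl E_sub in \<open>auto simp: avoiding_def irrefl_def sym_def intro: finite_subset\<close>)

text \<open>Contract the edge \<open>vc\<close>; the added 1 is the empty set, that is, the subgraph
  consisting of \<open>v\<close> alone.\<close>

lemma pendant_step:
  "card (rooted_edge_sets (avoiding E v) {c}) + 1 \<le> card (rooted_edge_sets E {v})"
proof -
  have "rooted_edge_sets (avoiding E v) {c} \<subseteq> rooted_edge_sets E (insert c {v})"
  proof
    fix F assume "F \<in> rooted_edge_sets (avoiding E v) {c}"
    then have F: "F \<subseteq> avoiding E v" "sym F" "F \<inter> {c} \<times> {c} = {}" "Domain F \<subseteq> reach F {c}"
      by (simp_all add: rooted_edge_sets_def)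
    have "reach F {c} \<subseteq> reach F (insert c {v})" by (rule reach_mono) auto
    moreover have "F \<inter> insert c {v} \<times> insert c {v} = {}"
      using F(1,3) unfolding avoiding_def by blast
    ultimately show "F \<in> rooted_edge_sets E (insert c {v})"
      using F(2) order_trans[OF F(1) avoiding_subset] order_trans[OF F(4)]
      by (simp add: rooted_edge_sets_def)
  qed
  then have "card (rooted_edge_sets (avoiding E v) {c}) \<le> card (rooted_edge_sets E (insert c {v}))"
    by (rule card_mono[OF finite_rooted_edge_sets[OF fin_E]])
  moreover have "card (rooted_edge_sets E (insert c {v}))
    + card (rooted_edge_sets (E - {(v, c), (c, v)}) {v}) \<le> card (rooted_edge_sets E {v})"
    by (rule card_rooted_edge_sets_step) (use fin_E sym v pendant_adj in auto)
  moreover have "1 \<le> card (rooted_edge_sets (E - {(v, c), (c, v)}) {v})"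
    by (rule card_rooted_edge_sets_pos) (use fin_E in auto)
  ultimately show ?thesis by linarith
qed

text \<open>The assumption leaves no slack in \<open>pendant_step\<close>. If \<open>c\<close> still
  separated the rest, \<open>cut_root_bound\<close> would exceed it; hence the rest is a block, and
  surplus edges would exceed it by \<open>rooted_block_bound_strict\<close>.\<close>

lemma pendant_equality:
  assumes le: "2 * card (rooted_edge_sets E {v}) \<le> card V * (card V - 1) + 4"
  shows "card (avoiding E v) \<le> 2 * (card V - 1) \<and>
    (\<forall>w \<in> V - {v, c}. V - {v, c} \<subseteq> reach (avoiding (avoiding E v) c) {w})"
proof -
  define W where "W = V - {v, c}"
  interpret R: single_rooted "avoiding E v" c W unfolding W_def by (rule rest_single_rooted)
  have W: "card V = card W + 2"
  proof -
    have "card W = card V - card {v, c}"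
      unfolding W_def using v c by (intro card_Diff_subset) auto
    moreover have "card {v, c} = 2" using v by simp
    ultimately show ?thesis using V_ge by simp
  qed
  have gt: "card V * (card V - 1) + 4 < 2 * card (rooted_edge_sets E {v})"
    if "w \<in> W" "\<not> W \<subseteq> reach (Restr (avoiding E v) W) {w}" for w
  proof -
    from R.disconnected_split[OF that] obtain A where
      "A \<subseteq> W" "A \<noteq> {}" "W - A \<noteq> {}" "avoiding E v \<inter> A \<times> (W - A) = {}" .
    then have "(card W + 1) * (card W + 2) + 2 < 2 * card (rooted_edge_sets (avoiding E v) {c})"
      using W V_ge by (intro R.cut_root_bound) auto
    then show ?thesis using pendant_step W by (simp add: algebra_simps)
  qed
  have blk: "w \<in> W \<Longrightarrow> W \<noteq> {w}" for w using W V_ge by auto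
  obtain w where w: "w \<in> W" using W V_ge by fastforce
  have con: "W \<subseteq> reach (Restr (avoiding E v) W) {w}" if "w \<in> W" for w
    using gt[OF that] le by linarith
  have mono: "reach (Restr (avoiding E v) W) {w} \<subseteq> reach (avoiding (avoiding E v) c) {w}" for w
    by (rule reach_mono) (auto simp: avoiding_def W_def)
  obtain i where i: "card W = Suc (Suc i)"
    using W V_ge by (intro that[of "card W - 2"]) simp
  have nin: "avoiding E v - {c} \<times> {c} = avoiding E v"
    using irrefl unfolding irrefl_def avoiding_def by blast
  have "card (avoiding E v) \<le> 2 * card W + 2"
  proof (rule ccontr)
    assume "\<not> ?thesis"
    then have "(card W + 1) * (card W + 2) + 2 < 2 * card (rooted_edge_sets (avoiding E v) {c})"
      using rooted_block_bound_strict[OF R.connected_rooted_block[OF w blk[OF w] con[OF w]] i R.irrefl]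
      unfolding nin by simp
    then show False using pendant_step W le by (simp add: algebra_simps)
  qed
  moreover have "\<forall>w \<in> W. W \<subseteq> reach (avoiding (avoiding E v) c) {w}"
    using con mono by blast
  ultimately show ?thesis using W unfolding W_def by simp
qed

end

end


section \<open>Biconnected graphs with as many edges as vertices\<close>

locale sparse_biconnected =
  fixes E :: "('a \<times> 'a) set" and U :: "'a set"
  assumes fin: "finite U" and sym: "sym E" and irrefl: "irrefl E" and E_sub: "E \<subseteq> U \<times> U"
    and nonsep: "\<And>x r. x \<in> U \<Longrightarrow> r \<in> U - {x} \<Longrightarrow> U - {x} \<subseteq> reach (avoiding E x) {r}"
    and U_ge: "3 \<le> card U"
    and sparse: "card E \<le> 2 * card U"
begin

lemma other_neighbour:
  assumes x: "x \<in> U" and z: "z \<in> U" "z \<noteq> x"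
  obtains b where "b \<noteq> z" "(x, b) \<in> E"
proof -
  have "card (U - {x, z}) = card U - card {x, z}"
    using x z fin by (intro card_Diff_subset) auto
  moreover have "card {x, z} = 2" using z by simp
  ultimately have "card (U - {x, z}) \<noteq> 0" using U_ge by simp
  then have "U - {x, z} \<noteq> {}" by (metis card.empty)
  then obtain y where y: "y \<in> U - {z}" "y \<notin> {x}" by blast
  have "y \<in> reach (avoiding E z) {x}" using nonsep[of z x] x z y by blast
  from reach_exit[OF this subset_refl y(2)] obtain a b where "a \<in> {x}" "(a, b) \<in> avoiding E z" .
  then show thesis using that[of b] unfolding avoiding_def by blast
qed

lemma degree_ge: "x \<in> U \<Longrightarrow> 2 \<le> card (E `` {x})"
proof -
  assume x: "x \<in> U"
  have "\<not> U \<subseteq> {x}" using U_ge card_mono[of "{x}" U] by auto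
  then obtain r where r: "r \<in> U" "r \<noteq> x" by blast
  obtain b where b: "(x, b) \<in> E" using other_neighbour[OF x r] by blast
  then have "b \<in> U" "b \<noteq> x" using E_sub irrefl unfolding irrefl_def by blast+
  then obtain d where d: "d \<noteq> b" "(x, d) \<in> E" using other_neighbour[OF x] by blast
  have "{b, d} \<subseteq> E `` {x}" using b d by blast
  moreover have "finite (E `` {x})" by (rule finite_subset[OF _ fin]) (use E_sub in blast)
  ultimately have "card {b, d} \<le> card (E `` {x})" by (intro card_mono)
  then show ?thesis using d by simp
qed

text \<open>All degrees are at least 2, while their sum \<open>card E\<close> is at most
  \<open>2 * card U\<close>.\<close>

lemma degree:
  assumes "x \<in> U"
  shows "card (E `` {x}) = 2"
proof (rule ccontr)
  assume neq: "card (E `` {x}) \<noteq> 2"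
  have fin': "finite (E `` {y})" for y by (rule finite_subset[OF _ fin]) (use E_sub in blast)
  have "E = (SIGMA y:U. E `` {y})" using E_sub by blast
  then have "card E = (\<Sum>y\<in>U. card (E `` {y}))"
    using card_SigmaI[OF fin, of "\<lambda>y. E `` {y}"] fin' by simp
  also have "\<dots> > (\<Sum>y\<in>U. 2)"
    by (rule sum_strict_mono_ex1[OF fin]) (use degree_ge neq assms in \<open>force+\<close>)
  finally show False using sparse by simp
qed

lemma neighbour_cases:
  assumes "(x, a) \<in> E" "(x, b) \<in> E" "a \<noteq> b" "(x, d) \<in> E"
  shows "d = a \<or> d = b"
proof -
  have "x \<in> U" using assms E_sub by blast
  note 2 = degree[OF this]
  have "{a, b} = E `` {x}"
    by (rule card_seteq) (use 2 assms in \<open>auto intro: card_ge_0_finite\<close>)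
  then show ?thesis using assms(4) by blast
qed

text \<open>A path missing some vertex can be prolonged at its end: its start does not separate, so
  an arc leaves the path from a later vertex, and inner vertices have both neighbours on the path
  already.\<close>

lemma path_extension:
  assumes c: "c \<in> U" and "t < card U"
  shows "\<exists>p. inj_on p {..t} \<and> p ` {..t} \<subseteq> U \<and> p 0 = c \<and> (\<forall>i<t. (p i, p (Suc i)) \<in> E)"
  using assms(2)
proof (induction t)
  case 0
  then show ?case using c by (intro exI[of _ "\<lambda>_. c"]) auto
next
  case (Suc t)
  then obtain p where p: "inj_on p {..t}" "p ` {..t} \<subseteq> U" "p 0 = c" "\<forall>i<t. (p i, p (Suc i)) \<in> E"
    by auto
  have "\<exists>b. b \<notin> p ` {..t} \<and> (p t, b) \<in> E"
  proof (cases "t = 0")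
    case True
    have "card (E `` {c}) \<noteq> 0" using degree[OF c] by simp
    then have "E `` {c} \<noteq> {}" by (metis card.empty)
    then obtain b where "(c, b) \<in> E" by blast
    moreover from this have "b \<noteq> c" using irrefl unfolding irrefl_def by blast
    ultimately show ?thesis using True p(3) by (intro exI[of _ b]) auto
  next
    case False
    have "card (p ` {..t}) = Suc t" using p(1) by (simp add: card_image)
    then have "\<not> U \<subseteq> p ` {..t}" using Suc.prems card_mono[of "p ` {..t}" U] by auto
    then obtain y where y: "y \<in> U" "y \<notin> p ` {..t}" by blast
    have "p t \<in> U" using p(2) by blast
    have ptc: "p t \<noteq> c"
    proof
      assume "p t = c"
      then have "p t = p 0" using p(3) by simp
      then have "t = 0" by (rule inj_onD[OF p(1)]) auto
      then show False using False by simp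
    qed
    have "y \<noteq> c" using y(2) p(3) by blast
    then have "y \<in> reach (avoiding E c) {p t}" using nonsep[of c "p t"] c ptc \<open>p t \<in> U\<close> y(1) by blast
    moreover have "{p t} \<subseteq> p ` {1..t}" using False by auto
    moreover have "y \<notin> p ` {1..t}" using y(2) by auto
    ultimately obtain a b where ab: "a \<in> p ` {1..t}" "b \<notin> p ` {1..t}" "(a, b) \<in> avoiding E c"
      by (rule reach_exit)
    then obtain j where j: "1 \<le> j" "j \<le> t" "a = p j" by auto
    have ab': "(p j, b) \<in> E" "b \<noteq> c" using ab(3) j(3) unfolding avoiding_def by blast+
    have "b \<notin> p ` {..t}"
    proof
      assume "b \<in> p ` {..t}"
      then obtain i where "i \<le> t" "b = p i" by auto
      moreover from this have "i \<noteq> 0" using ab'(2) p(3) by metis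
      ultimately have "b \<in> p ` {1..t}" by auto
      then show False using ab(2) by simp
    qed
    moreover have "j = t"
    proof (rule ccontr)
      assume "j \<noteq> t"
      then have "j < t" using j by simp
      then have 1: "(p j, p (Suc j)) \<in> E" using p(4) by simp
      obtain k where k: "j = Suc k" using j(1) by (cases j) auto
      then have "(p k, p j) \<in> E" using p(4) j by simp
      then have 2: "(p j, p k) \<in> E" using sym by (auto dest: symD)
      have "p (Suc j) \<noteq> p k"
      proof
        assume "p (Suc j) = p k"
        then have "Suc j = k" by (rule inj_onD[OF p(1)]) (use \<open>j < t\<close> k in auto)
        then show False using k by simp
      qed
      from neighbour_cases[OF 1 2 this ab'(1)] show False
        using \<open>b \<notin> p ` {..t}\<close> \<open>j < t\<close> k by auto
    qed
    ultimately show ?thesis using ab'(1) by blast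
  qed
  then obtain b where b: "b \<notin> p ` {..t}" "(p t, b) \<in> E" by blast
  let ?q = "p(Suc t := b)"
  have eq: "?q i = p i" if "i \<le> t" for i using that by auto
  have img: "?q ` {..t} = p ` {..t}" by (rule image_cong) (use eq in auto)
  have "inj_on ?q {..t}" using inj_on_cong[of "{..t}" ?q p] eq p(1) by auto
  then have "inj_on ?q {..Suc t}"
    unfolding atMost_Suc inj_on_insert using img b(1) by auto
  moreover have "?q ` {..Suc t} \<subseteq> U"
    unfolding atMost_Suc image_insert img using p(2) b(2) E_sub by auto
  moreover have "\<forall>i<Suc t. (?q i, ?q (Suc i)) \<in> E"
    using p(4) b(2) by (auto simp: less_Suc_eq)
  moreover have "?q 0 = c" using p(3) by simp
  ultimately show ?case by (intro exI[of _ ?q] conjI)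
qed

lemma cycle_enumeration:
  assumes c: "c \<in> U"
  obtains p where "bij_betw p {..<card U} U" "p 0 = c"
    "\<And>i j. i < card U \<Longrightarrow> j < card U \<Longrightarrow> (p i, p j) \<in> E \<longleftrightarrow> (i, j) \<in> parcs (cycle_graph (card U))"
proof -
  define m where "m = card U"
  have m: "3 \<le> m" using U_ge m_def by simp
  obtain p where "inj_on p {..m - 1}" "p ` {..m - 1} \<subseteq> U" and p0: "p 0 = c"
    and step: "\<forall>i<m - 1. (p i, p (Suc i)) \<in> E"
    using path_extension[OF c, of "m - 1"] m unfolding m_def by auto
  moreover have "{..m - 1} = {..<m}" using m by auto
  ultimately have p: "inj_on p {..<m}" "p ` {..<m} \<subseteq> U" by simp_all
  have img: "p ` {..<m} = U"
    by (rule card_seteq[OF fin p(2)]) (use p(1) in \<open>simp add: card_image m_def\<close>)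
  have inj: "p i = p j \<longleftrightarrow> i = j" if "i < m" "j < m" for i j
    using p(1) that by (auto dest: inj_onD)
  have up: "(p i, p (Suc i)) \<in> E" if "Suc i < m" for i using step that by auto
  have down: "(p (Suc i), p i) \<in> E" if "Suc i < m" for i using up[OF that] sym by (auto dest: symD)
  have inner: "j = k \<or> j = Suc (Suc k)" if "(p (Suc k), p j) \<in> E" "Suc (Suc k) < m" "j < m" for j k
  proof -
    have "p k \<noteq> p (Suc (Suc k))" using inj[of k "Suc (Suc k)"] that by simp
    then have "p j = p k \<or> p j = p (Suc (Suc k))"
      using neighbour_cases[OF down[of k] up[of "Suc k"] _ that(1)] that(2) by simp
    then show ?thesis using inj that by auto
  qed
  \<comment> \<open>Makes \<open>Suc (Suc l)\<close> the index of the last path vertex without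
    subtraction.\<close>
  define l where "l = m - 3"
  have ml: "m = Suc (Suc (Suc l))" using m l_def by simp
  let ?z = "Suc (Suc l)"
  have mz: "Suc ?z mod m = 0" unfolding ml by (rule mod_self)
  have "p (Suc l) \<noteq> p ?z" using inj[of "Suc l" ?z] ml by simp
  moreover have "p ?z \<in> U" "p (Suc l) \<in> U" using img ml by auto
  ultimately obtain b where b: "b \<noteq> p (Suc l)" "(p ?z, b) \<in> E"
    using other_neighbour by metis
  then have "b \<in> U" using E_sub by blast
  then obtain j where j: "j < m" "b = p j" using img by auto
  have "j \<noteq> Suc l" using b j by blast
  have "j \<noteq> ?z" using b j irrefl unfolding irrefl_def by blast
  \<comment> \<open>The second neighbour of the last vertex cannot be an inner vertex, whose degree
    is exhausted by the path; so the path closes up.\<close>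
  have "j = 0"
  proof (cases j)
    case (Suc k)
    have "(p (Suc k), p ?z) \<in> E" using b(2) j(2) Suc sym by (auto dest: symD)
    from inner[OF this] have "?z = k \<or> ?z = Suc (Suc k)" using j(1) Suc ml \<open>j \<noteq> ?z\<close> by auto
    then show ?thesis using \<open>j \<noteq> Suc l\<close> j(1) Suc ml by auto
  qed
  then have z0: "(p ?z, p 0) \<in> E" using b j by simp
  then have 0: "(p 0, p ?z) \<in> E" using sym by (auto dest: symD)
  have first: "j = 1 \<or> j = ?z" if "(p 0, p j) \<in> E" "j < m" for j
  proof -
    have "p 1 \<noteq> p ?z" using inj[of 1 ?z] ml by simp
    then have "p j = p 1 \<or> p j = p ?z" using neighbour_cases[OF _ 0 _ that(1)] up[of 0] ml by simp
    then show ?thesis using inj that ml by auto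
  qed
  have last: "j = Suc l \<or> j = 0" if "(p ?z, p j) \<in> E" "j < m" for j
  proof -
    have "p (Suc l) \<noteq> p 0" using inj[of "Suc l" 0] ml by simp
    then have "p j = p (Suc l) \<or> p j = p 0"
      using neighbour_cases[OF down[of "Suc l"] z0 _ that(1)] ml by simp
    then show ?thesis using inj that ml by auto
  qed
  have "(p i, p j) \<in> E \<longleftrightarrow> (i, j) \<in> parcs (cycle_graph m)" if ij: "i < m" "j < m" for i j
  proof
    assume E: "(p i, p j) \<in> E"
    consider "i = 0" | "i = ?z" | k where "i = Suc k" "Suc (Suc k) < m"
      using ij(1) ml by (cases i) force+
    then have "j = Suc i mod m \<or> i = Suc j mod m"
    proof cases
      case 1
      then show ?thesis using first[of j] E ij m mz by auto
    next
      case 2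
      then have "j = Suc l \<or> j = 0" using last[of j] E ij by blast
      moreover have "Suc (Suc l) mod m = Suc (Suc l)" using ij 2 by simp
      ultimately show ?thesis using 2 mz by metis
    next
      case 3
      then show ?thesis using inner[of k j] E ij by auto
    qed
    then show "(i, j) \<in> parcs (cycle_graph m)" using ij by (simp add: cycle_graph_def)
  next
    assume "(i, j) \<in> parcs (cycle_graph m)"
    then have "j = Suc i mod m \<or> i = Suc j mod m" by (simp add: cycle_graph_def)
    moreover have "(p a, p (Suc a mod m)) \<in> E \<and> (p (Suc a mod m), p a) \<in> E" if "a < m" for a
    proof (cases "Suc a = m")
      case True
      then have "a = ?z" using ml by simp
      then show ?thesis using z0 0 mz by metis
    next
      case False
      then show ?thesis using that up[of a] down[of a] by simp
    qed
    ultimately show "(p i, p j) \<in> E" using ij by auto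
  qed
  moreover have "bij_betw p {..<m} U" using p(1) img by (simp add: bij_betw_def)
  ultimately show thesis using that p0 unfolding m_def by blast
qed

end


section \<open>Connected subgraphs and cut vertices in terms of reachability\<close>

lemma (in wf_digraph) reachable_iff_reach:
  "u \<rightarrow>\<^sup>* v \<longleftrightarrow> u \<in> verts G \<and> v \<in> reach (arcs_ends G) {u}"
proof
  assume "u \<rightarrow>\<^sup>* v"
  then show "u \<in> verts G \<and> v \<in> reach (arcs_ends G) {u}"
    unfolding reachable_def by (induction rule: rtrancl_on_induct) (auto intro: reach_root reach_step)
next
  assume uv: "u \<in> verts G \<and> v \<in> reach (arcs_ends G) {u}"
  have "reach (arcs_ends G) {u} \<subseteq> {v. u \<rightarrow>\<^sup>* v}"
    by (rule reach_least) (use uv in \<open>auto intro: reachable_adj_trans\<close>)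
  then show "u \<rightarrow>\<^sup>* v" using uv by blast
qed

section \<open>Translation of the library notions into reachability\<close>

context pair_graph
begin

lemma sym_parcs: "sym (parcs G)"
  using pair_sym_arcs by (simp add: symmetric_def)

lemma irrefl_parcs: "irrefl (parcs G)"
  by (auto simp: irrefl_def dest: pair_no_loops)

lemma parcs_subset: "parcs G \<subseteq> pverts G \<times> pverts G"
  by (auto dest: in_arcsD1 in_arcsD2)

lemma reach_subset_pverts: "u \<in> pverts G \<Longrightarrow> reach (parcs G) {u} \<subseteq> pverts G"
  by (rule reach_least) (auto dest: in_arcsD2)

lemma connected_iff_reach:
  "connected (with_proj G) \<longleftrightarrow>
    pverts G \<noteq> {} \<and> (\<forall>u \<in> pverts G. pverts G \<subseteq> reach (parcs G) {u})"
proof -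
  have "u \<rightarrow>\<^sup>*\<^bsub>mk_symmetric G\<^esub> v \<longleftrightarrow> u \<in> pverts G \<and> v \<in> reach (parcs G) {u}" for u v
    using reachable_mk_symmetric_eq[OF sym_arcs, of u v] reachable_iff_reach[of u v] by simp
  then show ?thesis
    unfolding connected_def strongly_connected_def by auto
qed

lemma connectedI_reach:
  assumes "v \<in> pverts G" "pverts G \<subseteq> reach (parcs G) {v}"
  shows "connected (with_proj G)"
  unfolding connected_iff_reach
proof (intro conjI ballI subsetI)
  show "pverts G \<noteq> {}" using assms by blast
  fix u y assume u: "u \<in> pverts G" and y: "y \<in> pverts G"
  have "v \<in> reach (parcs G) {u}" using reach_sym[OF sym_parcs] u assms(2) by blast
  then show "y \<in> reach (parcs G) {u}" using reach_trans[of y _ v] y assms(2) by blast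
qed

text \<open>For symmetric arcs one-way reachability is already mutual, so the strongly connected
  components are the sets \<open>reach (parcs G) {u}\<close>.\<close>

lemma card_sccs: "card sccs = card ((\<lambda>u. reach (parcs G) {u}) ` pverts G)"
proof -
  have "scc_of u = reach (parcs G) {u}" if "u \<in> pverts G" for u
  proof -
    have "v \<in> pverts G \<and> u \<in> reach (parcs G) {v}" if "v \<in> reach (parcs G) {u}" for v
      using that reach_sym[OF sym_parcs] reach_subset_pverts[OF \<open>u \<in> pverts G\<close>] by blast
    then show ?thesis using that unfolding scc_of_def reachable_iff_reach by auto
  qed
  then have "scc_of ` pverts G = (\<lambda>u. reach (parcs G) {u}) ` pverts G" by (rule image_cong[OF refl])
  then show ?thesis using card_sccs_verts sccs_verts_conv_scc_of by simp
qed

lemma cut_vertex_iff_reach: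
  assumes con: "connected (with_proj G)"
  shows "cut_vertex G x \<longleftrightarrow> x \<in> pverts G \<and>
    (\<exists>u \<in> pverts G - {x}. \<not> pverts G - {x} \<subseteq> reach (avoiding (parcs G) x) {u})"
proof -
  define H where "H = \<lparr> pverts = pverts G - {x}, parcs = avoiding (parcs G) x \<rparr>"
  have del: "pre_digraph.del_vert (with_proj G) x = with_proj H"
    by (simp add: pre_digraph.del_vert_def with_proj_def H_def avoiding_def) auto
  interpret H: pair_graph H
    by unfold_locales
      (use parcs_subset irrefl_parcs sym_avoiding[OF sym_parcs, of x] in
        \<open>auto simp: H_def avoiding_def symmetric_def irrefl_def pair_finite_verts
          intro: finite_subset[OF _ pair_finite_arcs]\<close>)
  let ?r = "\<lambda>u. reach (avoiding (parcs G) x) {u}"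
  have cardH: "card (pre_digraph.sccs (with_proj H)) = card (?r ` (pverts G - {x}))"
    using H.card_sccs by (simp add: H_def)
  have "reach (parcs G) {u} = pverts G" if "u \<in> pverts G" for u
    using con that reach_subset_pverts[OF that] unfolding connected_iff_reach by blast
  then have "(\<lambda>u. reach (parcs G) {u}) ` pverts G = {pverts G}"
    using con unfolding connected_iff_reach by auto
  then have cardG: "card (pre_digraph.sccs (with_proj G)) = 1" using card_sccs by simp
  have sub: "?r u \<subseteq> pverts G - {x}" if "u \<in> pverts G - {x}" for u
    using H.reach_subset_pverts[of u] that by (simp add: H_def)
  have "1 < card (?r ` (pverts G - {x})) \<longleftrightarrow> (\<exists>u \<in> pverts G - {x}. \<not> pverts G - {x} \<subseteq> ?r u)"
  proof
    assume gt: "1 < card (?r ` (pverts G - {x}))"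
    show "\<exists>u \<in> pverts G - {x}. \<not> pverts G - {x} \<subseteq> ?r u"
    proof (rule ccontr)
      assume "\<not> ?thesis"
      then have "?r ` (pverts G - {x}) \<subseteq> {pverts G - {x}}" using sub by blast
      then have "card (?r ` (pverts G - {x})) \<le> card {pverts G - {x}}" by (intro card_mono) auto
      then show False using gt by simp
    qed
  next
    assume "\<exists>u \<in> pverts G - {x}. \<not> pverts G - {x} \<subseteq> ?r u"
    then obtain u w where uw: "u \<in> pverts G - {x}" "w \<in> pverts G - {x}" "w \<notin> ?r u" by blast
    have "w \<in> ?r w" by (rule reach_root) simp
    then have "?r u \<noteq> ?r w" using uw(3) by blast
    then have "card {?r u, ?r w} = 2" by simp
    moreover have "card {?r u, ?r w} \<le> card (?r ` (pverts G - {x}))"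
      by (rule card_mono) (use uw pair_finite_verts in auto)
    ultimately show "1 < card (?r ` (pverts G - {x}))" by simp
  qed
  then show ?thesis unfolding cut_vertex_def del cardG cardH by simp
qed

text \<open>A connected subgraph \<open>H\<close> containing \<open>v\<close> has vertex set
  \<open>reach (parcs H) {v}\<close>, so it is determined by its arcs and \<open>parcs\<close> is a
  bijection. The edgeless subgraph corresponds to the empty set.\<close>

lemma num_connected_subgraphs_at_eq:
  assumes v: "v \<in> pverts G"
  shows "num_connected_subgraphs_at G v = card (rooted_edge_sets (parcs G) {v})"
proof -
  have verts: "pverts H = reach (parcs H) {v}" if "H \<in> connected_subgraphs_at G v" for H
  proof -
    interpret H: pair_graph H using that by (simp add: connected_subgraphs_at_def)
    have "connected (with_proj H)" "v \<in> pverts H" using that by (simp_all add: connected_subgraphs_at_def)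
    then show ?thesis using H.reach_subset_pverts unfolding H.connected_iff_reach by blast
  qed
  have "bij_betw parcs (connected_subgraphs_at G v) (rooted_edge_sets (parcs G) {v})"
  proof (rule bij_betwI')
    fix H H' assume "H \<in> connected_subgraphs_at G v" "H' \<in> connected_subgraphs_at G v"
    then show "(parcs H = parcs H') = (H = H')" using verts[of H] verts[of H'] by auto
  next
    fix H assume H: "H \<in> connected_subgraphs_at G v"
    interpret H: pair_graph H using H by (simp add: connected_subgraphs_at_def)
    have "parcs H \<subseteq> parcs G" using H by (simp add: connected_subgraphs_at_def subgraph_def)
    moreover have "Domain (parcs H) \<subseteq> reach (parcs H) {v}"
      using H.parcs_subset verts[OF H] by auto
    moreover have "parcs H \<inter> {v} \<times> {v} = {}" using H.irrefl_parcs by (auto simp: irrefl_def)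
    ultimately show "parcs H \<in> rooted_edge_sets (parcs G) {v}"
      using H.sym_parcs by (simp add: rooted_edge_sets_def)
  next
    fix F assume "F \<in> rooted_edge_sets (parcs G) {v}"
    then have F: "F \<subseteq> parcs G" "sym F" "Domain F \<subseteq> reach F {v}"
      by (simp_all add: rooted_edge_sets_def)
    define H where "H = \<lparr> pverts = reach F {v}, parcs = F \<rparr>"
    have sub: "reach F {v} \<subseteq> pverts G"
      using reach_mono[OF F(1), of "{v}" "{v}"] reach_subset_pverts[OF v] by blast
    have F_sub: "a \<in> reach F {v} \<and> b \<in> reach F {v}" if "(a, b) \<in> F" for a b
      using F(3) that symD[OF F(2) that] by blast
    interpret H: pair_graph H
      using F_sub F(1,2) irrefl_parcs
      by unfold_locales (auto simp: H_def symmetric_def irrefl_def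
          intro: finite_subset[OF sub] finite_subset[OF F(1)] pair_finite_verts pair_finite_arcs)
    have vH: "v \<in> pverts H" unfolding H_def by (simp add: reach_root)
    have "connected (with_proj H)"
      by (rule H.connectedI_reach[OF vH]) (simp add: H_def)
    moreover have "subgraph (with_proj H) (with_proj G)"
      unfolding subgraph_def compatible_def
      using sub F(1) H.wf_digraph wf_digraph by (simp add: H_def)
    ultimately have "H \<in> connected_subgraphs_at G v"
      using vH H.pair_graph by (simp add: connected_subgraphs_at_def)
    then show "\<exists>H \<in> connected_subgraphs_at G v. F = parcs H"
      by (rule bexI[rotated]) (simp add: H_def)
  qed
  then show ?thesis unfolding num_connected_subgraphs_at_def by (rule bij_betw_same_card)
qed

end

lemma unique_cut_if_one_cut_vertex:
  assumes "G \<in> connected_graphs_with_cut_vertices n 1" "7 \<le> n"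
  obtains c where "unique_cut (parcs G) (pverts G) c"
proof -
  interpret pair_graph G using assms by (simp add: connected_graphs_with_cut_vertices_def)
  have con: "connected (with_proj G)" and n: "card (pverts G) = n"
    using assms by (simp_all add: connected_graphs_with_cut_vertices_def)
  have "card {v. cut_vertex G v} = 1" using assms by (simp add: connected_graphs_with_cut_vertices_def)
  then obtain c where c: "{v. cut_vertex G v} = {c}" by (rule card_1_singletonE)
  then have cut: "cut_vertex G x \<longleftrightarrow> x = c" for x by blast
  have cc: "cut_vertex G c" using cut by blast
  show thesis
  proof (rule that, unfold_locales)
    fix x assume "x \<in> pverts G"
    then show "pverts G \<subseteq> reach (parcs G) {x}" using con unfolding connected_iff_reach by blast
  next
    fix x r assume "x \<in> pverts G" "x \<noteq> c" "r \<in> pverts G - {x}"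
    then show "pverts G - {x} \<subseteq> reach (avoiding (parcs G) x) {r}"
      using cut[of x] cut_vertex_iff_reach[OF con, of x] by blast
  next
    show "\<exists>u \<in> pverts G - {c}. \<not> pverts G - {c} \<subseteq> reach (avoiding (parcs G) c) {u}" "c \<in> pverts G"
      using cc cut_vertex_iff_reach[OF con, of c] by blast+
  qed (use n assms(2) sym_parcs irrefl_parcs parcs_subset pair_finite_verts in auto)
qed


section \<open>The cycle with a pendant vertex\<close>

lemma parcs_cycle_with_pendant:
  "(i, j) \<in> parcs (cycle_with_pendant (Suc m)) \<longleftrightarrow>
    i < m \<and> j = Suc i mod m \<or> j < m \<and> i = Suc j mod m \<or> i = 0 \<and> j = m \<or> i = m \<and> j = 0"
proof (cases "m = 0")
  case False
  then show ?thesis by (auto simp: cycle_with_pendant_def attach_pendant_def cycle_graph_def)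
qed (auto simp: cycle_with_pendant_def attach_pendant_def cycle_graph_def)

lemma pverts_cycle_with_pendant: "pverts (cycle_with_pendant (Suc m)) = {..m}"
  by (auto simp: cycle_with_pendant_def attach_pendant_def cycle_graph_def)

locale labelled_cycle_with_pendant =
  fixes p :: "nat \<Rightarrow> 'a" and m :: nat
  assumes inj_p: "inj_on p {..m}" and m: "3 \<le> m"
begin

text \<open>A copy of \<open>cycle_with_pendant (Suc m)\<close> on vertices of type
  \<open>'a\<close>: the minimum ranges over graphs of that type only, so the competitor has to live
  there.\<close>

definition L :: "'a pair_pre_digraph" where
  "L = \<lparr> pverts = p ` {..m}, parcs = map_prod p p ` parcs (cycle_with_pendant (Suc m)) \<rparr>"

lemma p_eq: "i \<le> m \<Longrightarrow> j \<le> m \<Longrightarrow> p i = p j \<longleftrightarrow> i = j"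
  using inj_p by (auto dest: inj_onD)

lemma p_image: "i \<le> m \<Longrightarrow> X \<subseteq> {..m} \<Longrightarrow> p i \<in> p ` X \<longleftrightarrow> i \<in> X"
  using inj_on_image_mem_iff[OF inj_p, of i X] by simp

lemma mod_le: "Suc i mod m \<le> m"
  using m mod_less_divisor[of m "Suc i"] by linarith

lemma mod_neq_m: "m \<noteq> Suc i mod m"
  using m mod_less_divisor[of m "Suc i"] by linarith

lemma arc_cases:
  assumes "(a, b) \<in> parcs L"
  obtains (up) i where "i < m" "a = p i" "b = p (Suc i mod m)"
  | (down) i where "i < m" "a = p (Suc i mod m)" "b = p i"
  | (out) "a = p 0" "b = p m"
  | ("in") "a = p m" "b = p 0"
proof -
  obtain i j where "(i, j) \<in> parcs (cycle_with_pendant (Suc m))" "a = p i" "b = p j"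
    using assms by (auto simp: L_def)
  then show thesis using up down out "in" unfolding parcs_cycle_with_pendant by blast
qed

lemma arcs:
  shows arc_up: "i < m \<Longrightarrow> (p i, p (Suc i mod m)) \<in> parcs L"
    and arc_down: "i < m \<Longrightarrow> (p (Suc i mod m), p i) \<in> parcs L"
    and arc_out: "(p 0, p m) \<in> parcs L" and arc_in: "(p m, p 0) \<in> parcs L"
proof -
  have "(p i, p j) \<in> parcs L" if "(i, j) \<in> parcs (cycle_with_pendant (Suc m))" for i j
    using imageI[OF that, of "map_prod p p"] by (simp add: L_def)
  then show "i < m \<Longrightarrow> (p i, p (Suc i mod m)) \<in> parcs L"
    "i < m \<Longrightarrow> (p (Suc i mod m), p i) \<in> parcs L"
    "(p 0, p m) \<in> parcs L" "(p m, p 0) \<in> parcs L"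
    unfolding parcs_cycle_with_pendant by blast+
qed

lemma mod_neq:
  assumes "i < m"
  shows "Suc i mod m \<noteq> i"
proof (cases "Suc i = m")
  case True
  then have "Suc i mod m = 0" by simp
  then show ?thesis using True m by linarith
qed (use assms in simp)

lemma pair_graph_L: "pair_graph L"
proof
  have fin: "finite (parcs (cycle_with_pendant (Suc m)))"
    by (rule finite_subset[of _ "{..m} \<times> {..m}"])
      (use mod_le in \<open>auto simp: parcs_cycle_with_pendant\<close>)
  then show "finite (parcs L)" by (simp add: L_def)
  show "finite (pverts L)" by (simp add: L_def)
  have sub: "a \<in> pverts L \<and> b \<in> pverts L \<and> a \<noteq> b \<and> (b, a) \<in> parcs L" if "(a, b) \<in> parcs L" for a b
    using that
  proof (cases rule: arc_cases)
    case (up i)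
    then show ?thesis using mod_le[of i] mod_neq[of i] p_eq[of i "Suc i mod m"] arc_down[of i]
      by (auto simp: L_def)
  next
    case (down i)
    then show ?thesis using mod_le[of i] mod_neq[of i] p_eq[of i "Suc i mod m"] arc_up[of i]
      by (auto simp: L_def)
  next
    case out
    then show ?thesis using m p_eq[of 0 m] arc_in by (auto simp: L_def)
  next
    case "in"
    then show ?thesis using m p_eq[of 0 m] arc_out by (auto simp: L_def)
  qed
  show "symmetric (with_proj L)" using sub by (auto simp: symmetric_def sym_def)
  fix e assume "e \<in> parcs L"
  then show "fst e \<in> pverts L" "snd e \<in> pverts L" "fst e \<noteq> snd e"
    using sub[of "fst e" "snd e"] by auto
qed

sublocale L: pair_graph L by (rule pair_graph_L)

lemma card_pverts_L: "card (pverts L) = Suc m"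
  using inj_p by (simp add: L_def card_image)

section \<open>The labelled graph has exactly one cut vertex\<close>

lemma reach_upwards:
  assumes "x \<notin> p ` {..i}" "i < m"
  shows "p i \<in> reach (avoiding (parcs L) x) {p 0}"
  using assms
proof (induction i)
  case 0
  then show ?case by (simp add: reach_root)
next
  case (Suc i)
  have "(p i, p (Suc i)) \<in> parcs L" using arc_up[of i] Suc.prems by simp
  then have "(p i, p (Suc i)) \<in> avoiding (parcs L) x"
    using Suc.prems(1) unfolding avoiding_def by auto
  moreover have "p i \<in> reach (avoiding (parcs L) x) {p 0}" by (rule Suc.IH) (use Suc.prems in auto)
  ultimately show ?case by (rule reach_step[rotated])
qed

lemma reach_downwards:
  assumes "x \<notin> insert (p 0) (p ` {i..<m})" "i < m"
  shows "p i \<in> reach (avoiding (parcs L) x) {p 0}"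
proof -
  have "p (m - Suc k) \<in> reach (avoiding (parcs L) x) {p 0}"
    if "x \<notin> insert (p 0) (p ` {m - Suc k..<m})" "k < m" for k
    using that
  proof (induction k)
    case 0
    have "(p 0, p (m - 1)) \<in> parcs L" using arc_down[of "m - 1"] m by simp
    moreover have "p (m - 1) \<noteq> x" "p 0 \<noteq> x" using 0 by auto
    ultimately have "(p 0, p (m - 1)) \<in> avoiding (parcs L) x" unfolding avoiding_def by auto
    then show ?case using reach_step[OF reach_root[of "p 0" "{p 0}"]] by simp
  next
    case (Suc k)
    define j where "j = m - Suc (Suc k)"
    have j: "Suc j = m - Suc k" "Suc j < m" using Suc.prems(2) by (auto simp: j_def)
    have "(p (Suc j), p j) \<in> parcs L" using arc_down[of j] j(2) by simp
    moreover have "p (Suc j) \<noteq> x" "p j \<noteq> x" using Suc.prems(1) j(2) unfolding j_def[symmetric] by auto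
    ultimately have "(p (Suc j), p j) \<in> avoiding (parcs L) x" unfolding avoiding_def by auto
    moreover have "p (Suc j) \<in> reach (avoiding (parcs L) x) {p 0}"
      unfolding j(1) by (rule Suc.IH) (use Suc.prems in auto)
    ultimately show ?case unfolding j_def[symmetric] by (rule reach_step[rotated])
  qed
  from this[of "m - Suc i"] show ?thesis using assms by simp
qed

lemma reach_avoiding_noncut:
  assumes "x \<noteq> p 0"
  shows "pverts L - {x} \<subseteq> reach (avoiding (parcs L) x) {p 0}"
proof
  fix y assume "y \<in> pverts L - {x}"
  then obtain i where i: "i \<le> m" "y = p i" "p i \<noteq> x" by (auto simp: L_def)
  show "y \<in> reach (avoiding (parcs L) x) {p 0}"
  proof (cases "i = m")
    case True
    then have "(p 0, p i) \<in> avoiding (parcs L) x" using arc_out assms i unfolding avoiding_def by auto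
    then show ?thesis using reach_step[OF reach_root[of "p 0" "{p 0}"]] i(2) by simp
  next
    case False
    then have im: "i < m" using i by simp
    show ?thesis
    proof (cases "x \<in> p ` {..i}")
      case True
      then obtain k where k: "k \<le> i" "x = p k" by auto
      have "k \<noteq> i" using k i by auto
      have "x \<notin> p ` {i..<m}"
      proof
        assume "x \<in> p ` {i..<m}"
        then obtain l where "i \<le> l" "l < m" "p k = p l" using k(2) by auto
        then show False using p_eq[of k l] k(1) \<open>k \<noteq> i\<close> by simp
      qed
      then show ?thesis using reach_downwards[of x i] assms i im by auto
    next
      case False
      then show ?thesis using reach_upwards[of x i] i im by auto
    qed
  qed
qed

lemma connected_L: "connected (with_proj L)"
proof (rule L.connectedI_reach)
  show p0: "p 0 \<in> pverts L" by (simp add: L_def)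
  show "pverts L \<subseteq> reach (parcs L) {p 0}"
  proof
    fix y assume y: "y \<in> pverts L"
    show "y \<in> reach (parcs L) {p 0}"
    proof (cases "y = p m")
      case True
      then show ?thesis using reach_step[OF reach_root[of "p 0" "{p 0}"] arc_out] by simp
    next
      case False
      have "p m \<noteq> p 0" using p_eq[of m 0] m by simp
      from reach_avoiding_noncut[OF this] False y
      show ?thesis using reach_mono[OF avoiding_subset[of "parcs L" "p m"] subset_refl] by blast
    qed
  qed
qed

lemma cut_vertex_L: "cut_vertex L x \<longleftrightarrow> x = p 0"
proof
  assume "cut_vertex L x"
  then obtain u where u: "u \<in> pverts L - {x}" "\<not> pverts L - {x} \<subseteq> reach (avoiding (parcs L) x) {u}"
    unfolding L.cut_vertex_iff_reach[OF connected_L] by blast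
  show "x = p 0"
  proof (rule ccontr)
    assume "x \<noteq> p 0"
    note r = reach_avoiding_noncut[OF this]
    have "p 0 \<in> reach (avoiding (parcs L) x) {u}"
      using reach_sym[OF sym_avoiding[OF L.sym_parcs]] r u(1) by blast
    then have "pverts L - {x} \<subseteq> reach (avoiding (parcs L) x) {u}"
      using reach_trans[of _ _ "p 0"] r by blast
    then show False using u by blast
  qed
next
  assume x: "x = p 0"
  have "reach (avoiding (parcs L) x) {p m} \<subseteq> {p m}"
  proof (rule reach_least)
    fix a b assume ab: "a \<in> {p m}" "(a, b) \<in> avoiding (parcs L) x"
    then have ab': "(p m, b) \<in> parcs L" "b \<noteq> p 0" unfolding avoiding_def x by auto
    from ab'(1) show "b \<in> {p m}"
    proof (cases rule: arc_cases)
      case (up i)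
      then show ?thesis using p_eq[of m i] by simp
    next
      case (down i)
      then show ?thesis using p_eq[of m "Suc i mod m"] mod_le[of i] mod_neq_m[of i] by blast
    qed (use ab' in auto)
  qed simp
  moreover have "p 1 \<in> pverts L - {x}" "p m \<in> pverts L - {x}" "p 1 \<noteq> p m"
    using m p_eq[of 1 0] p_eq[of m 0] p_eq[of 1 m] by (auto simp: L_def x)
  ultimately have "\<not> pverts L - {x} \<subseteq> reach (avoiding (parcs L) x) {p m}" by blast
  then show "cut_vertex L x"
    unfolding L.cut_vertex_iff_reach[OF connected_L]
    using \<open>p m \<in> pverts L - {x}\<close> by (auto simp: L_def x)
qed

lemma L_one_cut_vertex: "L \<in> connected_graphs_with_cut_vertices (Suc m) 1"
proof -
  have "{v. cut_vertex L v} = {p 0}" using cut_vertex_L by blast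
  then show ?thesis
    using pair_graph_L connected_L card_pverts_L
    by (simp add: connected_graphs_with_cut_vertices_def)
qed

text \<open>The cycle edge with index \<open>i\<close> joins \<open>p i\<close> to its successor
  modulo \<open>m\<close>; those from \<open>lo\<close> to \<open>hi\<close> are removed. The larger
  index comes first so that the pairs form a \<open>SIGMA\<close> whose fibre over \<open>hi\<close>
  has \<open>Suc hi\<close> elements.\<close>

definition gap :: "nat \<times> nat \<Rightarrow> ('a \<times> 'a) set" where
  "gap = (\<lambda>(hi, lo). parcs L - (\<Union>i \<in> {lo..hi}. {(p i, p (Suc i mod m)), (p (Suc i mod m), p i)}))"

text \<open>A connected set of edges that contains the pendant edge but misses part of the cycle misses
  exactly the edges between its first and its last missing one, since these are cut off.\<close>

lemma rooted_edge_set_cases: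
  assumes F: "F \<in> rooted_edge_sets (parcs L) {p m}"
  shows "F \<in> {{}, parcs L} \<union> gap ` (SIGMA hi:{..<m}. {..hi})"
proof (cases "(p m, p 0) \<in> F")
  case False
  have F': "F \<subseteq> parcs L" "Domain F \<subseteq> reach F {p m}" "sym F"
    using F by (simp_all add: rooted_edge_sets_def)
  have only: "b = p 0" if "(p m, b) \<in> F" for b
  proof -
    have "(p m, b) \<in> parcs L" using that F' by blast
    then show ?thesis
    proof (cases rule: arc_cases)
      case (up i)
      then show ?thesis using p_eq[of m i] by simp
    next
      case (down i)
      then show ?thesis using p_eq[of m "Suc i mod m"] mod_le[of i] mod_neq_m[of i] by blast
    next
      case out
      then show ?thesis using m p_eq[of m 0] by simp
    qed
  qed
  have "reach F {p m} \<subseteq> {p m}"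
    by (rule reach_least) (use only False in auto)
  then have dom: "Domain F \<subseteq> {p m}" using F'(2) by blast
  have "F = {}"
  proof (rule equals0I, clarify)
    fix a b assume ab: "(a, b) \<in> F"
    then have "a = p m" using dom by blast
    then show False using only[of b] ab False by blast
  qed
  then show ?thesis by simp
next
  case True
  have F': "F \<subseteq> parcs L" "Domain F \<subseteq> reach F {p m}" "sym F"
    using F by (simp_all add: rooted_edge_sets_def)
  have symF: "(b, a) \<in> F" if "(a, b) \<in> F" for a b using F'(3) that by (rule symD)
  define M where "M = {i \<in> {..<m}. (p i, p (Suc i mod m)) \<notin> F}"
  have finM: "finite M" unfolding M_def by simp
  show ?thesis
  proof (cases "M = {}")
    case all: True
    have "parcs L \<subseteq> F"
    proof clarify
      fix a b assume "(a, b) \<in> parcs L"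
      then show "(a, b) \<in> F"
      proof (cases rule: arc_cases)
        case (up i)
        then show ?thesis using all unfolding M_def by blast
      next
        case (down i)
        then have "(b, a) \<in> F" using all unfolding M_def by blast
        then show ?thesis by (rule symF)
      qed (use True symF in auto)
    qed
    then show ?thesis using F'(1) by blast
  next
    case False
    define lo hi where "lo = Min M" and "hi = Max M"
    have loM: "lo \<in> M" and hiM: "hi \<in> M" using False finM by (auto simp: lo_def hi_def)
    have M_bounds: "lo \<le> i \<and> i \<le> hi" if "i \<in> M" for i
      using that finM by (auto simp: lo_def hi_def)
    have him: "hi < m" "lo \<le> hi" using hiM loM M_bounds unfolding M_def by auto
    \<comment> \<open>The vertices still attached to the pendant edge: two stretches of the cycle
      ending at the first and the last missing edge. The index \<open>m\<close> in the second
      stretch is the pendant vertex.\<close>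
    define X where "X = {..lo} \<union> {hi<..m}"
    have X_iff: "j \<in> X \<longleftrightarrow> Suc j mod m \<in> X" if "j < m" "j \<notin> M" for j
    proof -
      have "j \<noteq> lo" "j \<noteq> hi" using that loM hiM by auto
      then show ?thesis using that him by (cases "Suc j = m") (auto simp: X_def)
    qed
    have Xm: "X \<subseteq> {..m}" using him by (auto simp: X_def)
    have closed: "b \<in> p ` X" if "a \<in> p ` X" "(a, b) \<in> F" for a b
    proof -
      have "(a, b) \<in> parcs L" using that F' by blast
      then show ?thesis
      proof (cases rule: arc_cases)
        case (up i)
        then have "i \<in> X" using that(1) p_image[OF _ Xm, of i] by simp
        moreover have "i \<notin> M" using up that(2) unfolding M_def by simp
        ultimately show ?thesis using X_iff[of i] up by simp
      next
        case (down i)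
        then have "Suc i mod m \<in> X" using that(1) p_image[OF mod_le Xm, of i] by simp
        moreover have "(b, a) \<in> F" using that(2) by (rule symF)
        then have "i \<notin> M" using down unfolding M_def by simp
        ultimately show ?thesis using X_iff[of i] down by simp
      next
        case out
        then show ?thesis using him by (simp add: X_def)
      next
        case "in"
        then show ?thesis by (simp add: X_def)
      qed
    qed
    have "reach F {p m} \<subseteq> p ` X"
      by (rule reach_least) (use closed him in \<open>auto simp: X_def\<close>)
    then have dom: "Domain F \<subseteq> p ` X" using F'(2) by blast
    \<comment> \<open>A present edge with index between \<open>lo\<close> and \<open>hi\<close>
      would put \<open>p i\<close> in \<open>Domain F\<close> with \<open>i\<close> outside
      \<open>X\<close>.\<close>
    have M_eq: "i \<in> M \<longleftrightarrow> i \<in> {lo..hi}" if "i < m" for i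
    proof
      assume i: "i \<in> {lo..hi}"
      show "i \<in> M"
      proof (rule ccontr)
        assume "i \<notin> M"
        then have "(p i, p (Suc i mod m)) \<in> F" "i \<noteq> lo" "i \<noteq> hi"
          using that loM hiM unfolding M_def by auto
        then have "p i \<in> p ` X" using dom by blast
        then have "i \<in> X" using p_image[OF _ Xm, of i] that by simp
        then show False using i \<open>i \<noteq> lo\<close> by (auto simp: X_def)
      qed
    qed (use M_bounds in auto)
    have "F = gap (hi, lo)"
    proof (rule set_eqI, clarify)
      fix a b
      have gap_iff: "(a, b) \<in> gap (hi, lo) \<longleftrightarrow> (a, b) \<in> parcs L \<and>
        (\<forall>i \<in> {lo..hi}. (a, b) \<notin> {(p i, p (Suc i mod m)), (p (Suc i mod m), p i)})"
        by (simp add: gap_def)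
      show "(a, b) \<in> F \<longleftrightarrow> (a, b) \<in> gap (hi, lo)"
      proof
        assume ab: "(a, b) \<in> F"
        have "(a, b) \<notin> {(p i, p (Suc i mod m)), (p (Suc i mod m), p i)}" if "i \<in> {lo..hi}" for i
        proof
          assume "(a, b) \<in> {(p i, p (Suc i mod m)), (p (Suc i mod m), p i)}"
          then have "(p i, p (Suc i mod m)) \<in> F" using ab symF by auto
          moreover have "i \<in> M" using M_eq[of i] that him by auto
          ultimately show False unfolding M_def by blast
        qed
        then show "(a, b) \<in> gap (hi, lo)" using gap_iff ab F'(1) by blast
      next
        assume "(a, b) \<in> gap (hi, lo)"
        then have L: "(a, b) \<in> parcs L" and
          no: "\<forall>i \<in> {lo..hi}. (a, b) \<notin> {(p i, p (Suc i mod m)), (p (Suc i mod m), p i)}"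
          using gap_iff by blast+
        from L show "(a, b) \<in> F"
        proof (cases rule: arc_cases)
          case (up i)
          then have "i \<notin> {lo..hi}" using no by blast
          then have "i \<notin> M" using M_eq[OF up(1)] by blast
          then show ?thesis using up unfolding M_def by blast
        next
          case (down i)
          then have "i \<notin> {lo..hi}" using no by blast
          then have "i \<notin> M" using M_eq[OF down(1)] by blast
          then have "(b, a) \<in> F" using down unfolding M_def by blast
          then show ?thesis by (rule symF)
        qed (use True symF in auto)
      qed
    qed
    moreover have "(hi, lo) \<in> (SIGMA hi:{..<m}. {..hi})" using him by simp
    ultimately show ?thesis by blast
  qed
qed

text \<open>The sets are the empty one, the full one, and at most one for each of the m(m+1)/2
  pairs. An upper bound suffices, since this graph only serves as a competitor.\<close>

lemma num_connected_subgraphs_at_pendant_le: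
  "2 * num_connected_subgraphs_at L (p m) \<le> Suc m * m + 4"
proof -
  let ?S = "(SIGMA hi:{..<m}. {..hi})"
  have "2 * (\<Sum>i<k. Suc i) = Suc k * k" for k :: nat by (induction k) auto
  then have S: "2 * card ?S = Suc m * m" by simp
  have fin: "finite ?S" by simp
  have "rooted_edge_sets (parcs L) {p m} \<subseteq> {{}, parcs L} \<union> gap ` ?S"
    using rooted_edge_set_cases by blast
  then have "card (rooted_edge_sets (parcs L) {p m}) \<le> card ({{}, parcs L} \<union> gap ` ?S)"
    by (rule card_mono[rotated]) (use fin in simp)
  also have "\<dots> \<le> card {{}, parcs L} + card (gap ` ?S)" by (rule card_Un_le)
  also have "\<dots> \<le> 2 + card ?S"
    by (rule add_mono[OF order_trans[OF card_insert_le_m1[of 2]] card_image_le[OF fin]]) auto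
  finally show ?thesis
    using S L.num_connected_subgraphs_at_eq[of "p m"] by (simp add: L_def)
qed

end


section \<open>Minimal graphs\<close>

lemma isomorphic_cycle_with_pendantI:
  assumes G: "pair_graph G" and q: "bij_betw q {..m} (pverts G)"
    and arcs: "\<And>i j. i \<le> m \<Longrightarrow> j \<le> m \<Longrightarrow>
      (q i, q j) \<in> parcs G \<longleftrightarrow> (i, j) \<in> parcs (cycle_with_pendant (Suc m))"
  shows "\<exists>\<phi>. pre_digraph.digraph_isomorphism (with_proj G) \<phi>
    \<and> app_iso \<phi> (with_proj G) = with_proj (cycle_with_pendant (Suc m)) \<and> iso_verts \<phi> (q m) = m"
proof -
  interpret pair_graph G by (rule G)
  define g where "g = the_inv_into {..m} q"
  have g: "bij_betw g (pverts G) {..m}" unfolding g_def using q by (rule bij_betw_the_inv_into)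
  have gq: "g (q i) = i" if "i \<le> m" for i
    unfolding g_def using q that by (intro the_inv_into_f_f) (auto simp: bij_betw_def)
  have qg: "q (g a) = a" if "a \<in> pverts G" for a
    unfolding g_def using q that by (intro f_the_inv_into_f) (auto simp: bij_betw_def)
  have gm: "g a \<le> m" if "a \<in> pverts G" for a using g that by (auto simp: bij_betw_def)
  have sub: "i \<le> m \<and> j \<le> m" if "(i, j) \<in> parcs (cycle_with_pendant (Suc m))" for i j
    using that by (auto simp: cycle_with_pendant_def attach_pendant_def cycle_graph_def)
  have image: "map_prod g g ` parcs G = parcs (cycle_with_pendant (Suc m))"
  proof (intro subset_antisym subsetI)
    fix e assume "e \<in> map_prod g g ` parcs G"
    then obtain a b where "(a, b) \<in> parcs G" "e = (g a, g b)" by auto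
    then show "e \<in> parcs (cycle_with_pendant (Suc m))"
      using arcs[of "g a" "g b"] gm qg in_arcsD1[of a b] in_arcsD2[of a b] by simp
  next
    fix e assume e: "e \<in> parcs (cycle_with_pendant (Suc m))"
    obtain i j where ij: "e = (i, j)" by (cases e)
    then have le: "i \<le> m" "j \<le> m" using sub e by auto
    then have "(q i, q j) \<in> parcs G" using arcs e ij by simp
    then show "e \<in> map_prod g g ` parcs G"
      by (rule rev_image_eqI) (use gq le ij in simp)
  qed
  have inj: "inj_on (map_prod g g) (parcs G)"
    using map_prod_inj_on[OF bij_betw_imp_inj_on[OF g] bij_betw_imp_inj_on[OF g]]
    by (rule inj_on_subset) (rule parcs_subset)
  let ?\<phi> = "\<lparr> iso_verts = g, iso_arcs = map_prod g g, iso_head = snd, iso_tail = fst \<rparr>"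
  have "pre_digraph.digraph_isomorphism (with_proj G) ?\<phi>"
    unfolding pre_digraph.digraph_isomorphism_def
    using wf_digraph bij_betw_imp_inj_on[OF g] inj by simp
  moreover have "app_iso ?\<phi> (with_proj G) = with_proj (cycle_with_pendant (Suc m))"
    using image bij_betw_imp_surj_on[OF g]
    by (simp add: app_iso_def with_proj_def pverts_cycle_with_pendant)
  moreover have "iso_verts ?\<phi> (q m) = m" using gq by simp
  ultimately show ?thesis by blast
qed

context unique_cut
begin

text \<open>For a deleted vertex other than \<open>c\<close>, reachability from \<open>c\<close>
  becomes reachability from any vertex by symmetry; for \<open>c\<close> itself it is the second
  part of \<open>pendant_equality\<close>.\<close>

lemma rest_sparse_biconnected:
  assumes v: "v \<in> V" "v \<noteq> c" and K: "reach (avoiding E c) {v} = {v}"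
    and le: "2 * card (rooted_edge_sets E {v}) \<le> card V * (card V - 1) + 4"
  shows "sparse_biconnected (avoiding E v) (V - {v})"
proof
  interpret R: single_rooted "avoiding E v" c "V - {v, c}" by (rule rest_single_rooted[OF v K])
  note eq = pendant_equality[OF v K le]
  have card: "card (V - {v}) = card V - 1" using v fin by simp
  show "finite (V - {v})" using fin by simp
  show "sym (avoiding E v)" "irrefl (avoiding E v)" by (rule R.sym R.irrefl)+
  show "avoiding E v \<subseteq> (V - {v}) \<times> (V - {v})" using E_sub unfolding avoiding_def by blast
  show "3 \<le> card (V - {v})" "card (avoiding E v) \<le> 2 * card (V - {v})"
    using eq V_ge card by simp_all
  fix x r assume x: "x \<in> V - {v}" and r: "r \<in> V - {v} - {x}"
  show "V - {v} - {x} \<subseteq> reach (avoiding (avoiding E v) x) {r}"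
  proof (cases "x = c")
    case True
    have "V - {v} - {x} = V - {v, c}" using True by blast
    then show ?thesis using eq r True by simp
  next
    case False
    let ?F = "avoiding (avoiding E v) x"
    have all: "y \<in> reach ?F {c}" if "y \<in> V - {v} - {x}" for y
    proof (cases "y = c")
      case True
      then show ?thesis by (simp add: reach_root)
    next
      case neq: False
      then show ?thesis using R.reach_avoiding[of x] that x False by blast
    qed
    have "c \<in> reach ?F {r}" using reach_sym[OF sym_avoiding[OF R.sym]] all[OF r] by blast
    then show ?thesis using reach_trans[OF all] by blast
  qed
qed

lemma minimal_cases:
  assumes v: "v \<in> V" and le: "2 * card (rooted_edge_sets E {v}) \<le> card V * (card V - 1) + 4"
  shows "v \<noteq> c" "reach (avoiding E c) {v} = {v}"
proof -
  show vc: "v \<noteq> c" using bound_at_cut le by (metis not_less)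
  show "reach (avoiding E c) {v} = {v}" using bound_in_block[OF v vc] le by (metis not_less)
qed

end

theorem theorem3p12:
  fixes n :: nat and G\<^sub>0 :: "'a pair_pre_digraph" and v\<^sub>0 :: 'a
  assumes "n \<ge> 7"
    and "G\<^sub>0 \<in> connected_graphs_with_cut_vertices n 1"
    and "v\<^sub>0 \<in> pverts G\<^sub>0"
    and "num_connected_subgraphs_at G\<^sub>0 v\<^sub>0 =
      Min {num_connected_subgraphs_at G v | (G :: 'a pair_pre_digraph) v.
        G \<in> connected_graphs_with_cut_vertices n 1 \<and> v \<in> pverts G}"
  shows "\<exists>\<phi>. pre_digraph.digraph_isomorphism (with_proj G\<^sub>0) \<phi>
    \<and> app_iso \<phi> (with_proj G\<^sub>0) = with_proj (cycle_with_pendant n)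
    \<and> iso_verts \<phi> v\<^sub>0 = n - 1"
proof -
  interpret G: pair_graph G\<^sub>0 using assms(2) by (simp add: connected_graphs_with_cut_vertices_def)
  obtain c where "unique_cut (parcs G\<^sub>0) (pverts G\<^sub>0) c"
    using unique_cut_if_one_cut_vertex[OF assms(2,1)] .
  then interpret C: unique_cut "parcs G\<^sub>0" "pverts G\<^sub>0" c .
  have n: "card (pverts G\<^sub>0) = n" using assms(2) by (simp add: connected_graphs_with_cut_vertices_def)
  define m where "m = n - 1"
  have nm: "n = Suc m" "3 \<le> m" using assms(1) by (simp_all add: m_def)
  \<comment> \<open>The vertices of the given graph supply the \<open>m + 1\<close> distinct labels
    for the competitor.\<close>
  obtain p where "bij_betw p {0..<card (pverts G\<^sub>0)} (pverts G\<^sub>0)"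
    using ex_bij_betw_nat_finite[OF C.fin] by blast
  moreover have "{0..<card (pverts G\<^sub>0)} = {..m}" using n nm by auto
  ultimately interpret P: labelled_cycle_with_pendant p m
    using nm by unfold_locales (auto simp: bij_betw_def)
  have "num_connected_subgraphs_at P.L (p m) \<in> {num_connected_subgraphs_at G v |
    (G :: 'a pair_pre_digraph) v. G \<in> connected_graphs_with_cut_vertices n 1 \<and> v \<in> pverts G}"
  proof (intro CollectI exI conjI)
    show "P.L \<in> connected_graphs_with_cut_vertices n 1" using P.L_one_cut_vertex nm(1) by simp
    show "p m \<in> pverts P.L" by (simp add: P.L_def)
  qed (rule refl)
  then have "num_connected_subgraphs_at G\<^sub>0 v\<^sub>0 \<le> num_connected_subgraphs_at P.L (p m)"
    unfolding assms(4) by (rule Min_le[OF finite_num_connected_subgraphs_at])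
  then have le: "2 * card (rooted_edge_sets (parcs G\<^sub>0) {v\<^sub>0}) \<le>
      card (pverts G\<^sub>0) * (card (pverts G\<^sub>0) - 1) + 4"
    using P.num_connected_subgraphs_at_pendant_le G.num_connected_subgraphs_at_eq[OF assms(3)] n nm
    by simp
  note v = C.minimal_cases[OF assms(3) le]
  note adj = C.pendant_adj[OF assms(3) v]
  interpret S: sparse_biconnected "avoiding (parcs G\<^sub>0) v\<^sub>0" "pverts G\<^sub>0 - {v\<^sub>0}"
    by (rule C.rest_sparse_biconnected[OF assms(3) v le])
  have card: "card (pverts G\<^sub>0 - {v\<^sub>0}) = m" using n nm assms(3) C.fin by simp
  have "c \<in> pverts G\<^sub>0 - {v\<^sub>0}" using C.c v by blast
  from S.cycle_enumeration[OF this] obtain r where r: "bij_betw r {..<m} (pverts G\<^sub>0 - {v\<^sub>0})" "r 0 = c"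
    "\<And>i j. i < m \<Longrightarrow> j < m \<Longrightarrow>
      (r i, r j) \<in> avoiding (parcs G\<^sub>0) v\<^sub>0 \<longleftrightarrow> (i, j) \<in> parcs (cycle_graph m)"
    unfolding card by blast
  \<comment> \<open>The enumeration of the cycle starts at the cut vertex, so placing the pendant
    vertex at index \<open>m\<close> matches the pendant edge between 0 and
    \<open>m\<close>.\<close>
  define q where "q = r(m := v\<^sub>0)"
  have qm: "q m = v\<^sub>0" and ql: "\<And>i. i < m \<Longrightarrow> q i = r i" by (auto simp: q_def)
  have "bij_betw q {..<m} (pverts G\<^sub>0 - {v\<^sub>0})" using r(1) bij_betw_cong[of "{..<m}" q r] ql by auto
  then have "bij_betw q ({..<m} \<union> {m}) ((pverts G\<^sub>0 - {v\<^sub>0}) \<union> {v\<^sub>0})"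
    by (rule bij_betw_combine) (simp_all add: qm bij_betw_def)
  moreover have "{..<m} \<union> {m} = {..m}" "(pverts G\<^sub>0 - {v\<^sub>0}) \<union> {v\<^sub>0} = pverts G\<^sub>0"
    using assms(3) by auto
  ultimately have q: "bij_betw q {..m} (pverts G\<^sub>0)" by simp
  have q0: "q j = c \<longleftrightarrow> j = 0" if "j \<le> m" for j
    using inj_onD[OF bij_betw_imp_inj_on[OF q], of j 0] that ql[of 0] r(2) nm(2) by auto
  have sym: "(a, b) \<in> parcs G\<^sub>0 \<longleftrightarrow> (b, a) \<in> parcs G\<^sub>0" for a b
    using G.sym_parcs by (auto dest: symD)
  have arcs: "(q i, q j) \<in> parcs G\<^sub>0 \<longleftrightarrow> (i, j) \<in> parcs (cycle_with_pendant (Suc m))"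
    if ij: "i \<le> m" "j \<le> m" for i j
  proof -
    have L: "parcs (cycle_with_pendant (Suc m)) = parcs (cycle_graph m) \<union> {(0, m), (m, 0)}"
      by (simp add: cycle_with_pendant_def attach_pendant_def)
    have lt: "i < m \<and> j < m" if "(i, j) \<in> parcs (cycle_graph m)" for i j
      using that by (simp add: cycle_graph_def)
    consider "i = m" | "i < m" "j = m" | "i < m" "j < m" using ij by linarith
    then show ?thesis
    proof cases
      case 1
      then show ?thesis using adj[of "q j"] q0[of j] qm lt[of i j] ij nm(2) unfolding L by auto
    next
      case 2
      then show ?thesis
        using adj[of "q i"] sym[of "q i" v\<^sub>0] q0[of i] qm lt[of i j] ij nm(2) unfolding L by auto
    next
      case 3
      then have "r i \<noteq> v\<^sub>0" "r j \<noteq> v\<^sub>0" using r(1) by (auto simp: bij_betw_def)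
      then have "(r i, r j) \<in> avoiding (parcs G\<^sub>0) v\<^sub>0 \<longleftrightarrow> (r i, r j) \<in> parcs G\<^sub>0"
        by (simp add: avoiding_def)
      then show ?thesis using r(3)[OF 3] ql 3 unfolding L by auto
    qed
  qed
  show ?thesis
    using isomorphic_cycle_with_pendantI[OF G.pair_graph q arcs] qm nm(1) by simp
qed

end
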